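(* Every non-tubular constant Gauss curvature $K\neq0$ surface of parabolic rotation in $\mathbb{H}^3\subset\mathbb{R}^{3,1}$ is given, in terms of a pseudo-orthonormal basis, by $$(s,\theta)\mapsto\left(\tfrac{r^2(s)\left(\theta^2+\psi^2(s)\right)+1}{2r(s)},\ r(s),\ r(s)\theta,\ r(s)\psi(s)\right),$$ where $r,\psi$ are one of the following pairs of functions (with a constant $C$ or parameter $p$, and an auxiliary constant $\Xi$): Case $K<0$: $r(s)=\sqrt{\tfrac CK}\ \mathrm{dn}_p(\Xi s)$, $\psi(s)=Ks-\tfrac K\Xi\Pi(p^2;\Xi s\,|\,p)$, $\Xi=\sqrt{(K-1)C}$ with $C\le0$, $p=\sqrt{\tfrac1{1-K}}$. Case $K\in(0,1)$: (i) $r(s)=\sqrt{\tfrac{C}{K-1}}\ \mathrm{nc}_p(\Xi s)$, $\psi(s)=\tfrac1\Xi(E_p\circ\mathrm{am}_p)(\Xi s)$, $\Xi=\sqrt{-C}$ with $C<0$, $p=\sqrt{1-K}$; (ii) $r(s)=\sqrt{\tfrac CK}\ \mathrm{nc}_p(\Xi s)$, $\psi(s)=s-\tfrac1\Xi(E_p\circ\mathrm{am}_p)(\Xi s)$, $\Xi=\sqrt C$ with $C>0$, $p=\sqrt K$. Case $K=1$: $r(s)=p\cosh(ps)$, $\psi(s)=s-\tfrac{\tanh(ps)}{p}$, $p\in(0,\infty)$. Case $K>1$: $r(s)=\sqrt{\tfrac{C}{K-1}}\ \mathrm{dn}_p(\Xi s)$, $\psi(s)=Ks-\tfrac{K-1}{\Xi}\Pi(p^2;\Xi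 s\,|\,p)$, $\Xi=\sqrt{KC}$ with $C\ge0$, $p=\sqrt{\tfrac1K}$.
   Context: $\mathbb{H}^3$ is (the upper sheet of) the hyperboloid $\{x:(x,x)=-1\}$ in Minkowski space $\mathbb{R}^{3,1}$; in a pseudo-orthonormal basis $(x,y)=-x_0y_1-x_1y_0+x_2y_2+x_3y_3$. $K=k_1k_2$ denotes the extrinsic Gauss curvature (product of principal curvatures in $\mathbb{H}^3$); the intrinsic Gauss curvature is $K-1$. A surface of parabolic rotation is a surface invariant under a $1$-parameter group of isometries of $\mathbb{H}^3$ that acts as the identity on the orthogonal complement of a degenerate $2$-plane of signature $(+0)$; for a lightlike $\mathfrak{v}_1$, a unit spacelike $\mathfrak{e}_1\perp\mathfrak{v}_1$ and a lightlike $\mathfrak{v}_2\perp\mathfrak{e}_1$ with $(\mathfrak{v}_1,\mathfrak{v}_2)=-1$ it acts by $(\mathfrak{v}_2,\mathfrak{e}_1,\mathfrak{v}_1)\mapsto(\mathfrak{v}_2+\theta\mathfrak{e}_1+\frac{\theta^2}{2}\mathfrak{v}_1,\ \mathfrak{e}_1+\theta\mathfrak{v}_1,\ \mathfrak{v}_1)$. "Given by" is understood up to isometries of $\mathbb{H}^3$ and reparametrisation; degenerate values (such as $C=0$) where the expressions are undefined are to be disregarded. A surface is tubular if one of its principal curvatures is constant. $\mathrm{sn}_p,\mathrm{cn}_p,\mathrm{dn}_p$ denote the Jacobi elliptic functions of modulus $p$ (so that $\mathrm{sn}_p^2+\mathrm{cn}_p^2=\mathrm{dn}_p^2+p^2\mathrm{sn}_p^2=1$),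 $\mathrm{nc}_p=1/\mathrm{cn}_p$, and $\mathrm{am}_p$ is the Jacobi amplitude ($\mathrm{sn}_p=\sin\mathrm{am}_p$, $\mathrm{am}_p'=\mathrm{dn}_p$). Further, $\Pi(k;s\,|\,p)=\int_0^s\frac{du}{1-k\,\mathrm{sn}_p^2(u)}$ and $E_p(s)=\int_0^s\sqrt{1-p^2\sin^2u}\,du$. *)

theory Defs
  imports "HOL-Analysis.Analysis"
begin

section \<open>Minkowski space and hyperbolic space\<close>

text \<open>The timelike coordinate of the standard orthonormal basis is the first one.\<close>

definition mink :: "real^4 \<Rightarrow> real^4 \<Rightarrow> real" where
  "mink x y = - (x $ 1 * y $ 1) + x $ 2 * y $ 2 + x $ 3 * y $ 3 + x $ 4 * y $ 4"

definition hyp3 :: "(real^4) set" where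
  "hyp3 = {x. mink x x = - 1 \<and> x $ 1 > 0}"

definition pseudo_orthonormal ::
    "real^4 \<Rightarrow> real^4 \<Rightarrow> real^4 \<Rightarrow> real^4 \<Rightarrow> bool" where
  "pseudo_orthonormal b0 b1 b2 b3 \<longleftrightarrow>
     mink b0 b0 = 0 \<and> mink b1 b1 = 0 \<and> mink b0 b1 = - 1 \<and>
     mink b2 b2 = 1 \<and> mink b3 b3 = 1 \<and> mink b2 b3 = 0 \<and>
     mink b0 b2 = 0 \<and> mink b0 b3 = 0 \<and> mink b1 b2 = 0 \<and> mink b1 b3 = 0"


section \<open>Immersed surfaces and their curvatures\<close>

fun Ck_on :: "nat \<Rightarrow> ('a::real_normed_vector \<Rightarrow> 'b::real_normed_vector) \<Rightarrow> 'a set \<Rightarrow> bool" where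
  "Ck_on 0 f U \<longleftrightarrow> continuous_on U f"
| "Ck_on (Suc k) f U \<longleftrightarrow> (\<forall>u\<in>U. f differentiable (at u)) \<and>
     (\<forall>v. Ck_on k (\<lambda>u. frechet_derivative f (at u) v) U)"

text \<open>Only used on open sets.\<close>

definition smooth_on :: "('a::real_normed_vector \<Rightarrow> 'b::real_normed_vector) \<Rightarrow> 'a set \<Rightarrow> bool" where
  "smooth_on f U \<longleftrightarrow> (\<forall>k. Ck_on k f U)"

definition surface_in_hyp3 :: "(real \<times> real \<Rightarrow> real^4) \<Rightarrow> (real \<times> real) set \<Rightarrow> bool" where
  "surface_in_hyp3 f U \<longleftrightarrow> open U \<and> connected U \<and> U \<noteq> {} \<and> smooth_on f U \<and> f ` U \<subseteq> hyp3 \<and>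
     (\<forall>u\<in>U. inj (frechet_derivative f (at u)))"

text \<open>The unit normal of the surface inside hyperbolic space: it is tangent to \<open>hyp3\<close>, i.e.
  orthogonal to the position vector. The determinant selects one of the two
  unit normals continuously.\<close>

definition unit_normal :: "(real \<times> real \<Rightarrow> real^4) \<Rightarrow> real \<times> real \<Rightarrow> real^4" where
  "unit_normal f u = (THE n. mink n n = 1 \<and> mink n (f u) = 0 \<and>
     (\<forall>v. mink n (frechet_derivative f (at u) v) = 0) \<and>
     det (vector [f u, frechet_derivative f (at u) (1, 0), frechet_derivative f (at u) (0, 1), n]
           :: real^4^4) > 0)"

definition fund_form1 ::
    "(real \<times> real \<Rightarrow> real^4) \<Rightarrow> real \<times> real \<Rightarrow> real \<times> real \<Rightarrow> real \<times> real \<Rightarrow> real" where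
  "fund_form1 f u v w = mink (frechet_derivative f (at u) v) (frechet_derivative f (at u) w)"

definition fund_form2 ::
    "(real \<times> real \<Rightarrow> real^4) \<Rightarrow> real \<times> real \<Rightarrow> real \<times> real \<Rightarrow> real \<times> real \<Rightarrow> real" where
  "fund_form2 f u v w =
     mink (frechet_derivative (\<lambda>x. frechet_derivative f (at x) v) (at u) w) (unit_normal f u)"

text \<open>Eigenvalues of the shape operator \<open>A\<close>, where \<open>A\<close> is given by
  \<open>fund_form1 f u (A v) w = fund_form2 f u v w\<close>.\<close>

definition principal_curvatures :: "(real \<times> real \<Rightarrow> real^4) \<Rightarrow> real \<times> real \<Rightarrow> real set" where
  "principal_curvatures f u =
     {k. \<exists>v. v \<noteq> 0 \<and> (\<forall>w. fund_form2 f u v w = k * fund_form1 f u v w)}"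

text \<open>The shape operator is self-adjoint, so there are one (at umbilics, with multiplicity two)
  or two principal curvatures.\<close>

definition curv1 :: "(real \<times> real \<Rightarrow> real^4) \<Rightarrow> real \<times> real \<Rightarrow> real" where
  "curv1 f u = Min (principal_curvatures f u)"

definition curv2 :: "(real \<times> real \<Rightarrow> real^4) \<Rightarrow> real \<times> real \<Rightarrow> real" where
  "curv2 f u = Max (principal_curvatures f u)"

definition gauss_curvature :: "(real \<times> real \<Rightarrow> real^4) \<Rightarrow> real \<times> real \<Rightarrow> real" where
  "gauss_curvature f u = curv1 f u * curv2 f u"

definition tubular :: "(real \<times> real \<Rightarrow> real^4) \<Rightarrow> (real \<times> real) set \<Rightarrow> bool" where
  "tubular f U \<longleftrightarrow> curv1 f constant_on U \<or> curv2 f constant_on U"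


section \<open>Parabolic rotations\<close>

text \<open>The degenerate plane is spanned by \<open>v1\<close> and \<open>e1\<close>.\<close>

definition parabolic_rotation_group :: "(real \<Rightarrow> real^4 \<Rightarrow> real^4) \<Rightarrow> bool" where
  "parabolic_rotation_group R \<longleftrightarrow>
     (\<exists>v1 e1 v2. v1 \<noteq> 0 \<and> mink v1 v1 = 0 \<and> mink e1 e1 = 1 \<and> mink e1 v1 = 0 \<and>
        mink v2 v2 = 0 \<and> mink v2 e1 = 0 \<and> mink v1 v2 = - 1 \<and>
        (\<forall>\<theta>. linear (R \<theta>) \<and>
           R \<theta> v2 = v2 + \<theta> *\<^sub>R e1 + (\<theta>\<^sup>2 / 2) *\<^sub>R v1 \<and>
           R \<theta> e1 = e1 + \<theta> *\<^sub>R v1 \<and>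
           R \<theta> v1 = v1 \<and>
           (\<forall>x. mink x v1 = 0 \<and> mink x e1 = 0 \<longrightarrow> R \<theta> x = x)))"

definition surface_of_parabolic_rotation ::
    "(real \<times> real \<Rightarrow> real^4) \<Rightarrow> (real \<times> real) set \<Rightarrow> bool" where
  "surface_of_parabolic_rotation f U \<longleftrightarrow> surface_in_hyp3 f U \<and>
     (\<exists>R. parabolic_rotation_group R \<and> (\<forall>\<theta>. R \<theta> ` f ` U = f ` U))"

definition parabolic_param :: "real^4 \<Rightarrow> real^4 \<Rightarrow> real^4 \<Rightarrow> real^4 \<Rightarrow>
    (real \<Rightarrow> real) \<Rightarrow> (real \<Rightarrow> real) \<Rightarrow> real \<times> real \<Rightarrow> real^4" where
  "parabolic_param b0 b1 b2 b3 r \<psi> = (\<lambda>(s, \<theta>).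
     (((r s)\<^sup>2 * (\<theta>\<^sup>2 + (\<psi> s)\<^sup>2) + 1) / (2 * r s)) *\<^sub>R b0 + r s *\<^sub>R b1 +
     (r s * \<theta>) *\<^sub>R b2 + (r s * \<psi> s) *\<^sub>R b3)"

text \<open>Surfaces are immersed and may be traversed several times by their parametrisation, so a
  reparametrisation is a local diffeomorphism of \<open>U\<close> onto \<open>V\<close>. When \<open>f = g \<circ> \<phi>\<close> on \<open>U\<close> with \<open>f\<close>
  injective, \<open>\<phi>\<close> is injective as well, hence a diffeomorphism.\<close>

definition reparametrisation ::
    "(real \<times> real \<Rightarrow> real \<times> real) \<Rightarrow> (real \<times> real) set \<Rightarrow> (real \<times> real) set \<Rightarrow> bool" where
  "reparametrisation \<phi> U V \<longleftrightarrow> smooth_on \<phi> U \<and> \<phi> ` U = V \<and>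
     (\<forall>u\<in>U. bij (frechet_derivative \<phi> (at u)))"


section \<open>Elliptic integrals and Jacobi elliptic functions\<close>

text \<open>All functions take the modulus \<open>p\<close> (not the parameter \<open>p\<^sup>2\<close>), with \<open>0 \<le> p < 1\<close>.\<close>

definition ellF :: "real \<Rightarrow> real \<Rightarrow> real" where
  "ellF p s = (LBINT u=ereal 0..ereal s. 1 / sqrt (1 - p\<^sup>2 * (sin u)\<^sup>2))"

definition ellE :: "real \<Rightarrow> real \<Rightarrow> real" where
  "ellE p s = (LBINT u=ereal 0..ereal s. sqrt (1 - p\<^sup>2 * (sin u)\<^sup>2))"

text \<open>\<open>ellF p\<close> is an increasing bijection of the real line; the amplitude is its inverse, that
  is, the solution of \<open>am' = sqrt (1 - p\<^sup>2 sin\<^sup>2 am)\<close> with \<open>am 0 = 0\<close>.\<close>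

definition jacobi_am :: "real \<Rightarrow> real \<Rightarrow> real" where
  "jacobi_am p s = (THE x. ellF p x = s)"

definition jacobi_sn :: "real \<Rightarrow> real \<Rightarrow> real" where
  "jacobi_sn p s = sin (jacobi_am p s)"

definition jacobi_cn :: "real \<Rightarrow> real \<Rightarrow> real" where
  "jacobi_cn p s = cos (jacobi_am p s)"

definition jacobi_dn :: "real \<Rightarrow> real \<Rightarrow> real" where
  "jacobi_dn p s = sqrt (1 - p\<^sup>2 * (jacobi_sn p s)\<^sup>2)"

definition jacobi_nc :: "real \<Rightarrow> real \<Rightarrow> real" where
  "jacobi_nc p s = 1 / jacobi_cn p s"

definition ellPi :: "real \<Rightarrow> real \<Rightarrow> real \<Rightarrow> real" where
  "ellPi k s p = (LBINT u=ereal 0..ereal s. 1 / (1 - k * (jacobi_sn p u)\<^sup>2))"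

end

theory Submission
  imports Defs
begin

text \<open>In the coordinates $x = x_0 b_0 + r b_1 + r\theta b_2 + r\psi b_3$ belonging to a pseudo-orthonormal
  basis whose vectors \<open>b0\<close> and \<open>b3\<close> are fixed by the group, a parabolic rotation is the translation
  $\theta \mapsto \theta + t$, and $(\theta, \psi, 1/r)$ are the upper half-space coordinates.
  An invariant surface therefore lies over a profile curve in the $(\psi, 1/r)$ half-plane.
  The rotations are tangent to the surface at every point, whatever the parametrisation (\<open>rank_one\<close>):
  otherwise the invariant image would contain an open set of hyperbolic space, whereas a smooth image
  of a plane region is a null set.

  Let $e$ be the direction of the rotation, $m = d(1/r)/d\psi$ the Euclidean slope of the profile and
  $w = 1/(1+m^2)$. The direction $e$ is principal with curvature of square $w$; it would vanish where
  the profile is vertical, so $K \neq 0$ forces the profile to be a graph over $\psi$ (\<open>profile_graph\<close>).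
  The equation $k_1 k_2 = K$ becomes a first order equation for $m$ (\<open>slope_derivative\<close>), and it has
  the first integral $c = (w - K) r^2$ (\<open>first_integral\<close>). If $c = 0$ the surface is totally umbilic,
  hence tubular (\<open>first_integral_nonzero\<close>). If $c \neq 0$, the slope $m$ is a coordinate on the profile:
  $r$ is determined by $m$, and the parameter $s$ with $ds = d\psi / w$ satisfies
  $ds = -(r w / c)\, dm$, the integrand of an elliptic integral in $m$ (an elementary one if $K = 1$).

  With $C = -c$, the functions \<open>r\<close> and $\psi$ of each family satisfy $\psi'(s) = w$ for this very
  parameter, in all cases. It thus remains to write \<open>s\<close> explicitly as a function of $m$ by choosing the
  Jacobi amplitude $\alpha(m)$ (the lemmas \<open>profile_negative\<close> to \<open>profile_one\<close>).
  Since $\psi' = w > 0$, the profile has no self-intersections, and this is why the invariance of the image makes $(s, \theta)$ run through a full product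
  $I \times \mathbb{R}$ (\<open>parametrised_by_slope\<close>).\<close>

section \<open>A calculus of smooth functions\<close>

lemma Ck_on_cong:
  fixes f g :: "'a::real_normed_vector \<Rightarrow> 'b::real_normed_vector"
  assumes "open U" "\<And>u. u \<in> U \<Longrightarrow> f u = g u" "Ck_on k f U"
  shows "Ck_on k g U"
  using assms(2,3)
proof (induction k arbitrary: f g)
  case 0
  then show ?case by (simp cong: continuous_on_cong)
next
  case (Suc k)
  have d: "f differentiable (at u)" if "u \<in> U" for u
    using Suc.prems that by simp
  have "g differentiable (at u) \<and> frechet_derivative f (at u) = frechet_derivative g (at u)"
    if "u \<in> U" for u
  proof -
    have "(f has_derivative frechet_derivative f (at u)) (at u)"
      using d[OF that] frechet_derivative_works by blast
    then have "(g has_derivative frechet_derivative f (at u)) (at u)"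
      using has_derivative_transform_within_open[OF _ \<open>open U\<close> that] Suc.prems(1) by blast
    then show ?thesis
      using differentiableI frechet_derivative_at by blast
  qed
  then show ?case
    using Suc.prems(2) Suc.IH[of "\<lambda>u. frechet_derivative f (at u) v" "\<lambda>u. frechet_derivative g (at u) v" for v]
    by simp
qed

lemma Ck_on_Suc_imp: "Ck_on (Suc k) f U \<Longrightarrow> Ck_on k f U"
proof (induction k arbitrary: f)
  case 0
  then show ?case
    by (metis Ck_on.simps differentiable_at_withinI differentiable_imp_continuous_on
        differentiable_on_def)
next
  case (Suc k)
  then show ?case by (metis Ck_on.simps(2))
qed

lemma Ck_on_Suc_derivI:
  assumes "open U" "\<And>u. u \<in> U \<Longrightarrow> (f has_derivative D u) (at u)" "\<And>v. Ck_on k (\<lambda>u. D u v) U"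
  shows "Ck_on (Suc k) f U"
proof -
  have "frechet_derivative f (at u) = D u" if "u \<in> U" for u
    using assms(2) that frechet_derivative_at by metis
  then show ?thesis
    using assms Ck_on_cong[OF assms(1) _ assms(3)] differentiableI by force
qed

lemma smooth_on_derivative:
  "smooth_on f U \<Longrightarrow> u \<in> U \<Longrightarrow> (f has_derivative frechet_derivative f (at u)) (at u)"
  unfolding smooth_on_def by (metis Ck_on.simps(2) frechet_derivative_works)

lemma smooth_on_frechet: "smooth_on f U \<Longrightarrow> smooth_on (\<lambda>u. frechet_derivative f (at u) v) U"
  unfolding smooth_on_def by (metis Ck_on.simps(2))

lemma smooth_on_continuous: "smooth_on f U \<Longrightarrow> continuous_on U f"
  unfolding smooth_on_def by (metis Ck_on.simps(1))

text \<open>A function is smooth as soon as its differential is. In this way a parameter that is defined by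
  elliptic integrals is seen to be smooth from its first derivative alone.\<close>

lemma smooth_on_derivI:
  assumes "open U" "\<And>u. u \<in> U \<Longrightarrow> (f has_derivative D u) (at u)" "\<And>v. smooth_on (\<lambda>u. D u v) U"
  shows "smooth_on f U"
  unfolding smooth_on_def
proof
  fix k
  have "Ck_on (Suc k) f U"
    using assms unfolding smooth_on_def by (intro Ck_on_Suc_derivI) auto
  then show "Ck_on k f U" by (rule Ck_on_Suc_imp)
qed

lemma smooth_on_const: "open U \<Longrightarrow> smooth_on (\<lambda>u. c) U"
proof -
  assume "open U"
  have "Ck_on k (\<lambda>u. c) U" for k
    by (induction k arbitrary: c) auto
  then show ?thesis by (simp add: smooth_on_def)
qed

lemma Ck_on_linear:
  assumes "open U" "bounded_linear L" "Ck_on k f U"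
  shows "Ck_on k (\<lambda>u. L (f u)) U"
  using assms(3)
proof (induction k arbitrary: f)
  case 0
  then show ?case
    using bounded_linear.continuous_on[OF assms(2)] by simp
next
  case (Suc k)
  show ?case
  proof (rule Ck_on_Suc_derivI[OF assms(1)])
    show "((\<lambda>u. L (f u)) has_derivative (\<lambda>v. L (frechet_derivative f (at u) v))) (at u)" if "u \<in> U" for u
      using Suc.prems that by (intro bounded_linear.has_derivative[OF assms(2)])
        (simp add: frechet_derivative_works[symmetric])
    show "Ck_on k (\<lambda>u. L (frechet_derivative f (at u) v)) U" for v
      using Suc.prems by (intro Suc.IH) auto
  qed
qed

lemma smooth_on_linear:
  "open U \<Longrightarrow> bounded_linear L \<Longrightarrow> smooth_on f U \<Longrightarrow> smooth_on (\<lambda>u. L (f u)) U"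
  unfolding smooth_on_def by (blast intro: Ck_on_linear)

lemma Ck_on_add:
  assumes "open U" "Ck_on k f U" "Ck_on k g U"
  shows "Ck_on k (\<lambda>u. f u + g u) U"
  using assms(2,3)
proof (induction k arbitrary: f g)
  case 0
  then show ?case by (auto intro: continuous_on_add)
next
  case (Suc k)
  show ?case
  proof (rule Ck_on_Suc_derivI[OF assms(1)])
    show "((\<lambda>u. f u + g u) has_derivative
        (\<lambda>v. frechet_derivative f (at u) v + frechet_derivative g (at u) v)) (at u)" if "u \<in> U" for u
      using Suc.prems that frechet_derivative_works by (auto intro!: has_derivative_add)
  qed (use Suc in auto)
qed

lemma smooth_on_add:
  "open U \<Longrightarrow> smooth_on f U \<Longrightarrow> smooth_on g U \<Longrightarrow> smooth_on (\<lambda>u. f u + g u) U"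
  unfolding smooth_on_def by (blast intro: Ck_on_add)

lemma Ck_on_mult:
  fixes f g :: "'a::real_normed_vector \<Rightarrow> real"
  assumes "open U" "Ck_on k f U" "Ck_on k g U"
  shows "Ck_on k (\<lambda>u. f u * g u) U"
  using assms(2,3)
proof (induction k arbitrary: f g)
  case 0
  then show ?case by (auto intro: continuous_on_mult)
next
  case (Suc k)
  have fg: "Ck_on k f U" "Ck_on k g U"
    using Suc.prems Ck_on_Suc_imp by blast+
  show ?case
  proof (rule Ck_on_Suc_derivI[OF assms(1)])
    show "((\<lambda>u. f u * g u) has_derivative
        (\<lambda>v. f u * frechet_derivative g (at u) v + frechet_derivative f (at u) v * g u)) (at u)" if "u \<in> U" for u
      using Suc.prems that frechet_derivative_works by (auto intro!: has_derivative_mult)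
    show "Ck_on k (\<lambda>u. f u * frechet_derivative g (at u) v + frechet_derivative f (at u) v * g u) U" for v
      using Suc.prems by (intro Ck_on_add[OF assms(1)] Suc.IH fg) auto
  qed
qed

lemma smooth_on_mult:
  fixes f g :: "'a::real_normed_vector \<Rightarrow> real"
  shows "open U \<Longrightarrow> smooth_on f U \<Longrightarrow> smooth_on g U \<Longrightarrow> smooth_on (\<lambda>u. f u * g u) U"
  unfolding smooth_on_def by (blast intro: Ck_on_mult)

lemma smooth_on_inverse:
  fixes f :: "'a::real_normed_vector \<Rightarrow> real"
  assumes U: "open U" and f: "smooth_on f U" and nz: "\<And>u. u \<in> U \<Longrightarrow> f u \<noteq> 0"
  shows "smooth_on (\<lambda>u. inverse (f u)) U"
proof -
  have "Ck_on k (\<lambda>u. inverse (f u)) U" for k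
  proof (induction k)
    case 0
    show ?case using smooth_on_continuous[OF f] nz by (auto intro!: continuous_intros)
  next
    case (Suc k)
    show ?case
    proof (rule Ck_on_Suc_derivI[OF U])
      show "((\<lambda>u. inverse (f u)) has_derivative
        (\<lambda>v. (- 1) * (inverse (f u) * frechet_derivative f (at u) v * inverse (f u)))) (at u)" if "u \<in> U" for u
        using Deriv.has_derivative_inverse[OF nz[OF that] smooth_on_derivative[OF f that]]
        by simp
      have "Ck_on k (\<lambda>u. frechet_derivative f (at u) v) U" for v
        using smooth_on_frechet[OF f] by (simp add: smooth_on_def)
      moreover have "Ck_on k (\<lambda>u. - 1 :: real) U"
        using smooth_on_const[OF U, of "- 1 :: real"] unfolding smooth_on_def by blast
      ultimately show "Ck_on k (\<lambda>u. (- 1) * (inverse (f u) * frechet_derivative f (at u) v * inverse (f u))) U" for v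
        using Suc by (intro Ck_on_mult U)
    qed
  qed
  then show ?thesis by (simp add: smooth_on_def)
qed

lemma smooth_on_divide:
  fixes f g :: "'a::real_normed_vector \<Rightarrow> real"
  shows "open U \<Longrightarrow> smooth_on f U \<Longrightarrow> smooth_on g U \<Longrightarrow> (\<And>u. u \<in> U \<Longrightarrow> g u \<noteq> 0)
    \<Longrightarrow> smooth_on (\<lambda>u. f u / g u) U"
  unfolding divide_inverse by (intro smooth_on_mult smooth_on_inverse)

lemma smooth_on_Pair:
  fixes f g :: "'a::real_normed_vector \<Rightarrow> real"
  assumes U: "open U" and "smooth_on f U" "smooth_on g U"
  shows "smooth_on (\<lambda>u. (f u, g u)) U"
proof -
  have "bounded_linear (\<lambda>x::real. (x, 0::real))" "bounded_linear (\<lambda>x::real. (0::real, x))"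
    by (auto intro: bounded_linear_Pair bounded_linear_ident bounded_linear_zero)
  from smooth_on_add[OF U smooth_on_linear[OF U this(1) assms(2)] smooth_on_linear[OF U this(2) assms(3)]]
  show ?thesis by simp
qed

text \<open>The mean value theorem is applied in the direction \<open>v\<close> to the difference of \<open>g\<close> along \<open>t w\<close>,
  and then in the direction \<open>w\<close> to the derivative obtained.\<close>

lemma second_difference_quotient:
  fixes g :: "'a::real_normed_vector \<Rightarrow> real"
  assumes g: "smooth_on g U" and t: "0 < t"
    and sub: "\<And>x y. 0 \<le> x \<Longrightarrow> x \<le> t \<Longrightarrow> 0 \<le> y \<Longrightarrow> y \<le> t \<Longrightarrow> u + x *\<^sub>R v + y *\<^sub>R w \<in> U"
  shows "\<exists>x y. 0 \<le> x \<and> x \<le> t \<and> 0 \<le> y \<and> y \<le> t \<and>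
    g (u + t *\<^sub>R v + t *\<^sub>R w) - g (u + t *\<^sub>R v) - g (u + t *\<^sub>R w) + g u =
    t * t * frechet_derivative (\<lambda>z. frechet_derivative g (at z) v) (at (u + x *\<^sub>R v + y *\<^sub>R w)) w"
proof -
  let ?D = "\<lambda>z. frechet_derivative g (at z)"
  define F where "F = (\<lambda>x. g (u + x *\<^sub>R v + t *\<^sub>R w) - g (u + x *\<^sub>R v + 0 *\<^sub>R w))"
  have dg: "((\<lambda>x. g (u + x *\<^sub>R v + y *\<^sub>R w)) has_derivative (\<lambda>h. h * ?D (u + x *\<^sub>R v + y *\<^sub>R w) v)) (at x)"
    if "0 \<le> x" "x \<le> t" "0 \<le> y" "y \<le> t" for x y
  proof -
    have D: "(g has_derivative ?D (u + x *\<^sub>R v + y *\<^sub>R w)) (at (u + x *\<^sub>R v + y *\<^sub>R w))"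
      using smooth_on_derivative[OF g sub] that by blast
    have "((\<lambda>x. u + x *\<^sub>R v + y *\<^sub>R w) has_derivative (\<lambda>h. h *\<^sub>R v)) (at x)"
      by (auto intro!: derivative_eq_intros)
    from has_derivative_compose[OF this D]
    show ?thesis
      using linear_frechet_derivative[OF differentiableI[OF D]] by (simp add: linear_scale)
  qed
  have "\<exists>x. 0 < x \<and> x < t \<and> F t - F 0 = (t - 0) * (?D (u + x *\<^sub>R v + t *\<^sub>R w) v - ?D (u + x *\<^sub>R v + 0 *\<^sub>R w) v)"
  proof (rule MVT2[OF t])
    fix x assume x: "0 \<le> x" "x \<le> t"
    have "((\<lambda>x. g (u + x *\<^sub>R v + t *\<^sub>R w) - g (u + x *\<^sub>R v + 0 *\<^sub>R w)) has_derivative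
        (\<lambda>h. h * ?D (u + x *\<^sub>R v + t *\<^sub>R w) v - h * ?D (u + x *\<^sub>R v + 0 *\<^sub>R w) v)) (at x)"
      using t x by (intro has_derivative_diff dg) auto
    then show "(F has_real_derivative (?D (u + x *\<^sub>R v + t *\<^sub>R w) v - ?D (u + x *\<^sub>R v + 0 *\<^sub>R w) v)) (at x)"
      unfolding has_field_derivative_def F_def
      by (rule has_derivative_eq_rhs) (auto simp: algebra_simps)
  qed
  then obtain x where x: "0 < x" "x < t"
    "F t - F 0 = t * (?D (u + x *\<^sub>R v + t *\<^sub>R w) v - ?D (u + x *\<^sub>R v + 0 *\<^sub>R w) v)" by auto
  let ?E = "\<lambda>z. frechet_derivative (\<lambda>z. ?D z v) (at z)"
  have "((\<lambda>y. ?D (u + x *\<^sub>R v + y *\<^sub>R w) v) has_real_derivative ?E (u + x *\<^sub>R v + y *\<^sub>R w) w) (at y)"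
    if "0 \<le> y" "y \<le> t" for y
  proof -
    have D: "((\<lambda>z. ?D z v) has_derivative ?E (u + x *\<^sub>R v + y *\<^sub>R w)) (at (u + x *\<^sub>R v + y *\<^sub>R w))"
      using smooth_on_derivative[OF smooth_on_frechet[OF g] sub] that x by simp
    have "((\<lambda>y. u + x *\<^sub>R v + y *\<^sub>R w) has_derivative (\<lambda>h. h *\<^sub>R w)) (at y)"
      by (auto intro!: derivative_eq_intros)
    from has_derivative_compose[OF this D]
    show ?thesis
      using linear_frechet_derivative[OF differentiableI[OF D]]
      by (simp add: linear_scale has_field_derivative_def mult.commute[of "_ w"] mult_commute_abs)
  qed
  then have "\<exists>y. 0 < y \<and> y < t \<and> ?D (u + x *\<^sub>R v + t *\<^sub>R w) v - ?D (u + x *\<^sub>R v + 0 *\<^sub>R w) v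
      = (t - 0) * ?E (u + x *\<^sub>R v + y *\<^sub>R w) w"
    using t by (intro MVT2) auto
  then obtain y where "0 < y" "y < t" "?D (u + x *\<^sub>R v + t *\<^sub>R w) v - ?D (u + x *\<^sub>R v + 0 *\<^sub>R w) v
      = t * ?E (u + x *\<^sub>R v + y *\<^sub>R w) w" by auto
  then show ?thesis
    using x(1,2) x(3) unfolding F_def
    by (intro exI[of _ x] exI[of _ y]) (simp add: algebra_simps)
qed

text \<open>The second difference of \<open>g\<close> over a small parallelogram is symmetric in its two sides, and by
  \<open>second_difference_quotient\<close> it approximates either mixed derivative.\<close>

lemma smooth_on_second_derivative_symmetric:
  fixes g :: "'a::real_normed_vector \<Rightarrow> real"
  assumes U: "open U" and g: "smooth_on g U" and u: "u \<in> U"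
  shows "frechet_derivative (\<lambda>z. frechet_derivative g (at z) v) (at u) w
       = frechet_derivative (\<lambda>z. frechet_derivative g (at z) w) (at u) v"
proof (rule ccontr)
  let ?H = "\<lambda>v w z. frechet_derivative (\<lambda>z. frechet_derivative g (at z) v) (at z) w"
  assume ne: "?H v w u \<noteq> ?H w v u"
  define e where "e = \<bar>?H v w u - ?H w v u\<bar> / 2"
  have e: "e > 0" using ne by (simp add: e_def)
  have near: "\<exists>d>0. \<forall>z. dist z u < d \<longrightarrow> z \<in> U \<and> \<bar>?H v w z - ?H v w u\<bar> < e" for v w
  proof -
    have "isCont (?H v w) u"
      using smooth_on_continuous[OF smooth_on_frechet[OF smooth_on_frechet[OF g]]] U u
      by (simp add: continuous_on_eq_continuous_at)
    then obtain d where "d > 0" "\<And>z. dist z u < d \<Longrightarrow> \<bar>?H v w z - ?H v w u\<bar> < e"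
      using e unfolding continuous_at_eps_delta dist_real_def by blast
    moreover obtain d' where "d' > 0" "ball u d' \<subseteq> U"
      using U u open_contains_ball by blast
    ultimately show ?thesis
      by (intro exI[of _ "min d d'"]) (auto simp: dist_commute subset_iff)
  qed
  obtain d1 where d1: "d1 > 0" "\<And>z. dist z u < d1 \<Longrightarrow> z \<in> U \<and> \<bar>?H v w z - ?H v w u\<bar> < e"
    using near by blast
  obtain d2 where d2: "d2 > 0" "\<And>z. dist z u < d2 \<Longrightarrow> z \<in> U \<and> \<bar>?H w v z - ?H w v u\<bar> < e"
    using near by blast
  \<comment> \<open>The parallelogram with sides \<open>t v\<close> and \<open>t w\<close> fits into both balls.\<close>
  define t where "t = min d1 d2 / (2 * (norm v + norm w + 1))"
  have N: "norm v + norm w + 1 > 0" by (smt (verit) norm_ge_zero)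
  have t: "t > 0" using d1 d2 N by (simp add: t_def)
  have small: "norm (x *\<^sub>R v + y *\<^sub>R w) < min d1 d2" if "0 \<le> x" "x \<le> t" "0 \<le> y" "y \<le> t" for x y
  proof -
    have "norm (x *\<^sub>R v + y *\<^sub>R w) \<le> t * norm v + t * norm w"
      using that by (intro order_trans[OF norm_triangle_ineq] add_mono) (auto intro!: mult_right_mono)
    also have "\<dots> \<le> t * (norm v + norm w + 1)" using t by (simp add: algebra_simps)
    also have "\<dots> = min d1 d2 / 2"
      using N unfolding t_def by (metis (no_types, lifting) divide_divide_eq_left less_irrefl
          mult.commute nonzero_eq_divide_eq)
    also have "\<dots> < min d1 d2" using d1(1) d2(1) by linarith
    finally show ?thesis .
  qed
  have dist: "dist (u + x *\<^sub>R v + y *\<^sub>R w) u < min d1 d2" if "0 \<le> x" "x \<le> t" "0 \<le> y" "y \<le> t" for x y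
    using small[OF that] by (simp add: dist_norm add.assoc)
  have sub: "u + x *\<^sub>R v + y *\<^sub>R w \<in> U" if "0 \<le> x" "x \<le> t" "0 \<le> y" "y \<le> t" for x y
    using d1(2) dist[OF that] by simp
  obtain x y where xy: "0 \<le> x" "x \<le> t" "0 \<le> y" "y \<le> t"
    "g (u + t *\<^sub>R v + t *\<^sub>R w) - g (u + t *\<^sub>R v) - g (u + t *\<^sub>R w) + g u = t * t * ?H v w (u + x *\<^sub>R v + y *\<^sub>R w)"
    using second_difference_quotient[OF g t sub] by blast
  have sub': "u + x *\<^sub>R w + y *\<^sub>R v \<in> U" if "0 \<le> x" "x \<le> t" "0 \<le> y" "y \<le> t" for x y
    using sub[of y x] that by (simp add: algebra_simps)
  obtain x' y' where xy': "0 \<le> x'" "x' \<le> t" "0 \<le> y'" "y' \<le> t"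
    "g (u + t *\<^sub>R w + t *\<^sub>R v) - g (u + t *\<^sub>R w) - g (u + t *\<^sub>R v) + g u = t * t * ?H w v (u + x' *\<^sub>R w + y' *\<^sub>R v)"
    using second_difference_quotient[OF g t sub'] by blast
  have "t * t * ?H v w (u + x *\<^sub>R v + y *\<^sub>R w) = t * t * ?H w v (u + x' *\<^sub>R w + y' *\<^sub>R v)"
    using xy(5) xy'(5) by (simp add: algebra_simps)
  then have eq: "?H v w (u + x *\<^sub>R v + y *\<^sub>R w) = ?H w v (u + x' *\<^sub>R w + y' *\<^sub>R v)"
    using t by simp
  have 1: "\<bar>?H v w (u + x *\<^sub>R v + y *\<^sub>R w) - ?H v w u\<bar> < e"
    using d1(2) dist[OF xy(1-4)] by simp
  have "dist (u + x' *\<^sub>R w + y' *\<^sub>R v) u < d2"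
    using dist[OF xy'(3,4,1,2)] by (simp add: algebra_simps)
  then have 2: "\<bar>?H w v (u + x' *\<^sub>R w + y' *\<^sub>R v) - ?H w v u\<bar> < e"
    using d2(2) by blast
  show False using 1 2 eq unfolding e_def by (simp add: abs_if split: if_splits)
qed

lemma constant_if_derivative_zero:
  fixes g :: "'a::real_normed_vector \<Rightarrow> real"
  assumes "open U" "connected U" "\<And>u. u \<in> U \<Longrightarrow> (g has_derivative (\<lambda>v. 0)) (at u)" "a \<in> U" "b \<in> U"
  shows "g a = g b"
  using has_derivative_zero_unique_connected[of U g] assms by metis

lemma connected_nonzero_same_sign:
  fixes g :: "'a::topological_space \<Rightarrow> real"
  assumes "connected U" "continuous_on U g" "\<And>u. u \<in> U \<Longrightarrow> g u \<noteq> 0" "a \<in> U" "b \<in> U"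
  shows "0 < g a * g b"
proof -
  have "connected (g ` U)" using assms connected_continuous_image by blast
  then have iv: "x \<in> g ` U" if "y \<in> g ` U" "z \<in> g ` U" "y \<le> x" "x \<le> z" for x y z
    using that connectedD_interval by metis
  have "0 \<notin> g ` U" using assms(3) by auto
  then have "\<not> (g a < 0 \<and> 0 < g b)" "\<not> (g b < 0 \<and> 0 < g a)"
    using iv[of "g a" "g b" 0] iv[of "g b" "g a" 0] assms(4,5) by auto
  then show ?thesis
    using assms(3-5) by (metis linorder_neqE_linordered_idom mult_neg_neg mult_pos_pos)
qed

section \<open>Minkowski geometry\<close>

lemma bounded_bilinear_mink: "bounded_bilinear mink"
proof (rule bilinear_conv_bounded_bilinear[THEN iffD1])
  show "bilinear mink"
    unfolding bilinear_def mink_def by (auto intro!: linearI simp: algebra_simps)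
qed

interpretation mink: bounded_bilinear mink
  by (rule bounded_bilinear_mink)

lemmas mink_bilinear_simps = mink.add_left mink.add_right mink.diff_left mink.diff_right
  mink.scaleR_left mink.scaleR_right mink.minus_left mink.minus_right mink.zero_left mink.zero_right

lemma mink_commute: "mink x y = mink y x"
  by (simp add: mink_def mult.commute)

lemma three_dim_Cauchy_Schwarz:
  fixes a b c x y z :: real
  shows "(a * x + b * y + c * z)\<^sup>2 \<le> (a\<^sup>2 + b\<^sup>2 + c\<^sup>2) * (x\<^sup>2 + y\<^sup>2 + z\<^sup>2)"
proof -
  have "(a\<^sup>2 + b\<^sup>2 + c\<^sup>2) * (x\<^sup>2 + y\<^sup>2 + z\<^sup>2) - (a * x + b * y + c * z)\<^sup>2
    = (a * y - b * x)\<^sup>2 + (a * z - c * x)\<^sup>2 + (b * z - c * y)\<^sup>2"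
    by (simp add: power2_eq_square algebra_simps)
  also have "\<dots> \<ge> 0" by simp
  finally show ?thesis by simp
qed

text \<open>The reversed Cauchy-Schwarz inequality: a timelike vector has a spacelike orthogonal complement.\<close>

lemma orthogonal_to_timelike:
  assumes t: "mink t t < 0" and x: "mink t x = 0" and "x \<noteq> 0"
  shows "mink x x > 0"
proof -
  define S T where "S = (x$2)\<^sup>2 + (x$3)\<^sup>2 + (x$4)\<^sup>2" and "T = (t$2)\<^sup>2 + (t$3)\<^sup>2 + (t$4)\<^sup>2"
  have T: "T < (t$1)\<^sup>2" using t by (simp add: T_def mink_def power2_eq_square)
  then have t1: "(t$1)\<^sup>2 > 0"
    unfolding T_def by (smt (verit) zero_le_power2)
  have eq: "t$1 * x$1 = t$2 * x$2 + t$3 * x$3 + t$4 * x$4"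
    using x by (simp add: mink_def)
  have le: "(t$1)\<^sup>2 * (x$1)\<^sup>2 \<le> T * S"
    using three_dim_Cauchy_Schwarz[of "t$2" "x$2" "t$3" "x$3" "t$4" "x$4"] eq
    unfolding S_def T_def by (metis power_mult_distrib)
  have "S > 0"
  proof (rule ccontr)
    assume "\<not> S > 0"
    then have "S = 0" unfolding S_def by (smt (verit) zero_le_power2)
    then have z: "x$2 = 0" "x$3 = 0" "x$4 = 0"
      unfolding S_def by (smt (verit) zero_le_power2 zero_eq_power2)+
    moreover have "x$1 = 0" using eq z t1 by simp
    ultimately have "x = 0" by (simp add: vec_eq_iff forall_4)
    then show False using \<open>x \<noteq> 0\<close> by simp
  qed
  then have "T * S < (t$1)\<^sup>2 * S" using T by simp
  then have "(t$1)\<^sup>2 * (x$1)\<^sup>2 < (t$1)\<^sup>2 * S" using le by linarith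
  then have "(x$1)\<^sup>2 < S" using t1 by simp
  then show ?thesis by (simp add: S_def mink_def power2_eq_square)
qed

lemma mink_hyp3_lightlike_neg:
  assumes x: "x \<in> hyp3" and v: "mink v v = 0" "v$1 > 0"
  shows "mink x v < 0"
proof -
  have "(x$2 * v$2 + x$3 * v$3 + x$4 * v$4)\<^sup>2
     \<le> ((x$2)\<^sup>2 + (x$3)\<^sup>2 + (x$4)\<^sup>2) * ((v$2)\<^sup>2 + (v$3)\<^sup>2 + (v$4)\<^sup>2)"
    by (rule three_dim_Cauchy_Schwarz)
  also have "\<dots> = ((x$1)\<^sup>2 - 1) * (v$1)\<^sup>2"
  proof -
    have "(x$2)\<^sup>2 + (x$3)\<^sup>2 + (x$4)\<^sup>2 = (x$1)\<^sup>2 - 1" "(v$2)\<^sup>2 + (v$3)\<^sup>2 + (v$4)\<^sup>2 = (v$1)\<^sup>2"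
      using x v by (auto simp: hyp3_def mink_def power2_eq_square)
    then show ?thesis by simp
  qed
  also have "\<dots> < (x$1 * v$1)\<^sup>2" using v by (simp add: power_mult_distrib left_diff_distrib)
  finally have "\<bar>x$2 * v$2 + x$3 * v$3 + x$4 * v$4\<bar> < \<bar>x$1 * v$1\<bar>"
    using abs_square_less_1 by (metis power2_abs power2_less_imp_less abs_ge_zero)
  moreover have "x$1 * v$1 > 0" using x v by (simp add: hyp3_def)
  ultimately show ?thesis by (simp add: mink_def)
qed

lemma lightlike_nth1_nonzero: "mink v v = 0 \<Longrightarrow> v \<noteq> 0 \<Longrightarrow> v$1 \<noteq> 0"
proof
  assume "mink v v = 0" "v \<noteq> 0" and 1: "v$1 = 0"
  then have "(v$2)\<^sup>2 + (v$3)\<^sup>2 + (v$4)\<^sup>2 = 0"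
    by (simp add: mink_def power2_eq_square)
  then have "v$2 = 0" "v$3 = 0" "v$4 = 0"
    by (smt (verit) zero_le_power2 zero_eq_power2)+
  with 1 have "v = 0" by (simp add: vec_eq_iff forall_4)
  then show False using \<open>v \<noteq> 0\<close> by simp
qed

lemma pseudo_orthonormal_simps:
  assumes "pseudo_orthonormal b0 b1 b2 b3"
  shows "mink b0 b0 = 0" "mink b1 b1 = 0" "mink b0 b1 = - 1" "mink b1 b0 = - 1"
    "mink b2 b2 = 1" "mink b3 b3 = 1" "mink b2 b3 = 0" "mink b3 b2 = 0"
    "mink b0 b2 = 0" "mink b2 b0 = 0" "mink b0 b3 = 0" "mink b3 b0 = 0"
    "mink b1 b2 = 0" "mink b2 b1 = 0" "mink b1 b3 = 0" "mink b3 b1 = 0"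
  using assms by (auto simp: pseudo_orthonormal_def mink_commute)

text \<open>Pairing a combination of the basis with the basis recovers its coefficients. So the linear
  map from coefficients to vectors is injective, and hence onto.\<close>

lemma pseudo_orthonormal_expansion:
  assumes b: "pseudo_orthonormal b0 b1 b2 b3"
  shows "x = (- mink x b1) *\<^sub>R b0 + (- mink x b0) *\<^sub>R b1 + mink x b2 *\<^sub>R b2 + mink x b3 *\<^sub>R b3"
proof -
  define T where "T = (\<lambda>c::real^4. c$1 *\<^sub>R b0 + c$2 *\<^sub>R b1 + c$3 *\<^sub>R b2 + c$4 *\<^sub>R b3)"
  have lin: "linear T"
    unfolding T_def by (auto intro!: linearI simp: algebra_simps)
  have dual: "mink (T c) b1 = - (c$1)" "mink (T c) b0 = - (c$2)" "mink (T c) b2 = c$3" "mink (T c) b3 = c$4" for c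
    unfolding T_def by (simp_all add: mink_bilinear_simps pseudo_orthonormal_simps[OF b])
  have "c = 0" if "T c = 0" for c
    using dual[of c] that by (simp add: vec_eq_iff forall_4 mink.zero_left)
  then have "inj T" using lin by (simp add: linear_injective_0)
  then have "surj T" using linear_injective_imp_surjective[OF lin] by simp
  then obtain c where "x = T c" by (metis surjD)
  then have "(- mink x b1) *\<^sub>R b0 + (- mink x b0) *\<^sub>R b1 + mink x b2 *\<^sub>R b2 + mink x b3 *\<^sub>R b3 = T c"
    using dual[of c] by (simp add: T_def)
  then show ?thesis using \<open>x = T c\<close> by simp
qed

lemma pseudo_orthonormal_mink:
  assumes b: "pseudo_orthonormal b0 b1 b2 b3"
  shows "mink x y = - mink x b0 * mink y b1 - mink x b1 * mink y b0
    + mink x b2 * mink y b2 + mink x b3 * mink y b3"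
  by (subst pseudo_orthonormal_expansion[OF b, of x])
     (simp add: mink_bilinear_simps mink_commute[of _ y])

lemma vector4_nth:
  "(vector [a, b, c, d] :: 'a::zero^4) $ 1 = a" "(vector [a, b, c, d] :: 'a^4) $ 2 = b"
  "(vector [a, b, c, d] :: 'a^4) $ 3 = c" "(vector [a, b, c, d] :: 'a^4) $ 4 = d"
  unfolding vector_def by simp_all

text \<open>Three linear equations in four unknowns have a nonzero solution; it is orthogonal to the
  timelike vector \<open>v1 + v2\<close>, hence spacelike, and can be normalised.\<close>

lemma unit_spacelike_completion:
  assumes "mink v1 v1 = 0" "mink v2 v2 = 0" "mink v1 v2 = - 1"
  shows "\<exists>e3. mink e3 e3 = 1 \<and> mink e3 v1 = 0 \<and> mink e3 v2 = 0 \<and> mink e3 e1 = 0"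
proof -
  define L where "L = (\<lambda>x. vector [mink x v1, mink x v2, mink x e1, 0] :: real^4)"
  have "linear L"
    unfolding L_def by (rule linearI) (simp_all add: vec_eq_iff forall_4 vector4_nth mink_bilinear_simps)
  moreover have "\<not> surj L"
  proof
    assume "surj L"
    then obtain x where "axis 4 1 = L x" by (metis surjD)
    then have "(axis 4 1 :: real^4) $ 4 = L x $ 4" by simp
    then show False by (simp add: L_def vector4_nth)
  qed
  ultimately have "\<not> inj L" using linear_injective_imp_surjective by blast
  with \<open>linear L\<close> obtain x where x: "x \<noteq> 0" "L x = 0" by (auto simp: linear_injective_0)
  then have o: "mink x v1 = 0" "mink x v2 = 0" "mink x e1 = 0"
    by (auto simp: L_def vec_eq_iff forall_4 vector4_nth)
  have "mink (v1 + v2) (v1 + v2) < 0" "mink (v1 + v2) x = 0"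
    using assms o by (simp_all add: mink_bilinear_simps mink_commute[of v2 v1] mink_commute[of _ x])
  then have pos: "mink x x > 0" using x(1) by (rule orthogonal_to_timelike)
  have "mink ((1 / sqrt (mink x x)) *\<^sub>R x) ((1 / sqrt (mink x x)) *\<^sub>R x) = 1"
    using pos by (simp add: mink_bilinear_simps field_simps)
  then show ?thesis
    using o by (intro exI[of _ "(1 / sqrt (mink x x)) *\<^sub>R x"]) (simp add: mink_bilinear_simps)
qed

lemma det_vector_scale_last:
  "det (vector [a, b, c, k *\<^sub>R d] :: real^4^4) = k * det (vector [a, b, c, d] :: real^4^4)"
proof -
  let ?r = "\<lambda>i. (vector [a, b, c, 0] :: real^4^4) $ i"
  have e: "(vector [a, b, c, x] :: real^4^4) = (\<chi> i. if i = 4 then x else ?r i)" for x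
    by (subst vec_eq_iff) (simp add: forall_4 vector4_nth)
  have "det (\<chi> i. if i = 4 then k *s d else ?r i) = k * det (\<chi> i. if i = 4 then d else ?r i)"
    by (rule det_row_mul)
  then show ?thesis
    unfolding e[of d] e[of "k *\<^sub>R d"] by (simp only: scalar_mult_eq_scaleR)
qed

lemma det_vector_nonzero:
  assumes "\<And>y. mink y a = 0 \<Longrightarrow> mink y b = 0 \<Longrightarrow> mink y c = 0 \<Longrightarrow> mink y d = 0 \<Longrightarrow> y = 0"
  shows "det (vector [a, b, c, d] :: real^4^4) \<noteq> 0"
proof -
  let ?A = "vector [a, b, c, d] :: real^4^4"
  have "x = 0" if "?A *v x = 0" for x
  proof -
    define y :: "real^4" where "y = vector [- (x$1), x$2, x$3, x$4]"
    have y: "mink y z = z$1 * x$1 + z$2 * x$2 + z$3 * x$3 + z$4 * x$4" for z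
      by (simp add: y_def mink_def vector4_nth)
    have "(?A *v x) $ i = ?A $ i $ 1 * x$1 + ?A $ i $ 2 * x$2 + ?A $ i $ 3 * x$3 + ?A $ i $ 4 * x$4" for i
      by (simp add: matrix_vector_mult_def sum_4)
    from this[of 1] this[of 2] this[of 3] this[of 4] that
    have "mink y a = 0" "mink y b = 0" "mink y c = 0" "mink y d = 0"
      by (simp_all add: y vector4_nth)
    then have "y = 0" by (rule assms)
    then show "x = 0"
      by (simp add: y_def vec_eq_iff forall_4 vector4_nth)
  qed
  then obtain B where "B ** ?A = mat 1" using matrix_left_invertible_ker[of ?A] by blast
  then show ?thesis using invertible_det_nz invertible_left_inverse by blast
qed

lemma continuous_on_det_vector:
  fixes a b c d :: "'a::topological_space \<Rightarrow> real^4"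
  assumes "continuous_on U a" "continuous_on U b" "continuous_on U c" "continuous_on U d"
  shows "continuous_on U (\<lambda>u. det (vector [a u, b u, c u, d u] :: real^4^4))"
proof -
  have "continuous_on U (\<lambda>u. (vector [a u, b u, c u, d u] :: real^4^4) $ i $ j)" for i j
  proof -
    have "continuous_on U (\<lambda>u. (vector [a u, b u, c u, d u] :: real^4^4) $ i)"
      using exhaust_4[of i] assms by (auto simp: vector4_nth)
    then show ?thesis by (rule continuous_on_component)
  qed
  then show ?thesis
    unfolding det_def
    by (intro continuous_on_sum continuous_on_mult continuous_on_const continuous_on_prod)
qed

text \<open>The orbits become translations of the coordinate $\theta$. The vector \<open>b0\<close> has to be
  future-pointing for \<open>r\<close> to be positive, so if the given \<open>v1\<close> is past-pointing, the signs
  of \<open>v1\<close>, \<open>v2\<close> and \<open>e1\<close> are reversed, which preserves the form of the rotations.\<close>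

lemma parabolic_rotation_group_basis:
  assumes R: "parabolic_rotation_group R"
  shows "\<exists>b0 b1 b2 b3. pseudo_orthonormal b0 b1 b2 b3 \<and> (\<forall>x\<in>hyp3. mink x b0 < 0) \<and>
    (\<forall>\<theta> x. mink (R \<theta> x) b0 = mink x b0 \<and>
       mink (R \<theta> x) b2 = mink x b2 - \<theta> * mink x b0 \<and> mink (R \<theta> x) b3 = mink x b3)"
proof -
  obtain v1 e1 v2 where v: "v1 \<noteq> 0" "mink v1 v1 = 0" "mink e1 e1 = 1" "mink e1 v1 = 0"
    "mink v2 v2 = 0" "mink v2 e1 = 0" "mink v1 v2 = - 1"
    and R: "\<And>\<theta>. linear (R \<theta>)" "\<And>\<theta>. R \<theta> v2 = v2 + \<theta> *\<^sub>R e1 + (\<theta>\<^sup>2 / 2) *\<^sub>R v1"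
       "\<And>\<theta>. R \<theta> e1 = e1 + \<theta> *\<^sub>R v1" "\<And>\<theta>. R \<theta> v1 = v1"
       "\<And>\<theta> x. mink x v1 = 0 \<Longrightarrow> mink x e1 = 0 \<Longrightarrow> R \<theta> x = x"
    using R unfolding parabolic_rotation_group_def by metis
  obtain e3 where e3: "mink e3 e3 = 1" "mink e3 v1 = 0" "mink e3 v2 = 0" "mink e3 e1 = 0"
    using unit_spacelike_completion v by blast
  have po: "pseudo_orthonormal v1 v2 e1 e3"
    using v e3 by (simp add: pseudo_orthonormal_def mink_commute)
  note po_simps = pseudo_orthonormal_simps[OF po]
  have Rx: "R t x = (- mink x v2) *\<^sub>R v1 + (- mink x v1) *\<^sub>R (v2 + t *\<^sub>R e1 + (t\<^sup>2 / 2) *\<^sub>R v1)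
      + mink x e1 *\<^sub>R (e1 + t *\<^sub>R v1) + mink x e3 *\<^sub>R e3" for t x
  proof -
    have "R t e3 = e3" using R(5) e3 by simp
    then show ?thesis
      by (subst pseudo_orthonormal_expansion[OF po, of x])
         (simp only: linear_add[OF R(1)] linear_scale[OF R(1)] R(2-4))
  qed
  have act: "mink (R t x) v1 = mink x v1" "mink (R t x) e1 = mink x e1 - t * mink x v1"
    "mink (R t x) e3 = mink x e3" for t x
    unfolding Rx by (simp_all add: mink_bilinear_simps po_simps)
  show ?thesis
  proof (cases "v1$1 > 0")
    case True
    then have "\<forall>x\<in>hyp3. mink x v1 < 0" using mink_hyp3_lightlike_neg v(2) by blast
    then show ?thesis using po act by metis
  next
    case False
    then have "(- v1)$1 > 0" using lightlike_nth1_nonzero[OF v(2,1)] by simp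
    then have "\<forall>x\<in>hyp3. mink x (- v1) < 0"
      using mink_hyp3_lightlike_neg[of _ "- v1"] v(2) by (simp add: mink_bilinear_simps)
    moreover have "pseudo_orthonormal (- v1) (- v2) (- e1) e3"
      using po by (simp add: pseudo_orthonormal_def mink_bilinear_simps)
    moreover have "mink (R \<theta> x) (- v1) = mink x (- v1) \<and>
        mink (R \<theta> x) (- e1) = mink x (- e1) - \<theta> * mink x (- v1) \<and> mink (R \<theta> x) e3 = mink x e3" for \<theta> x
      by (simp add: mink_bilinear_simps act)
    ultimately show ?thesis by metis
  qed
qed

section \<open>Surfaces invariant under a parabolic rotation\<close>

abbreviation D :: "('a::real_normed_vector \<Rightarrow> 'b::real_normed_vector) \<Rightarrow> 'a \<Rightarrow> 'a \<Rightarrow> 'b" where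
  "D g u v \<equiv> frechet_derivative g (at u) v"

lemma D_cong:
  assumes "open U" "u \<in> U" "\<And>x. x \<in> U \<Longrightarrow> g x = h x" "smooth_on g U"
  shows "D g u v = D h u v"
proof -
  have "g differentiable at u" using smooth_on_derivative[OF assms(4,2)] by (rule differentiableI)
  from frechet_derivative_transform_within_open[OF this assms(1,2,3)] show ?thesis by simp
qed

lemma D_mult:
  fixes g h :: "'a::real_normed_vector \<Rightarrow> real"
  assumes "smooth_on g U" "smooth_on h U" "u \<in> U"
  shows "D (\<lambda>x. g x * h x) u v = g u * D h u v + D g u v * h u"
  using frechet_derivative_at[OF has_derivative_mult[OF smooth_on_derivative[OF assms(1,3)]
        smooth_on_derivative[OF assms(2,3)]]]
  by metis

lemma D_add:
  assumes "smooth_on g U" "smooth_on h U" "u \<in> U"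
  shows "D (\<lambda>x. g x + h x) u v = D g u v + D h u v"
  using frechet_derivative_at[OF has_derivative_add[OF smooth_on_derivative[OF assms(1,3)]
        smooth_on_derivative[OF assms(2,3)]]]
  by metis

lemma D_linear:
  assumes "bounded_linear L" "smooth_on g U" "u \<in> U"
  shows "D (\<lambda>x. L (g x)) u v = L (D g u v)"
  using frechet_derivative_at[OF bounded_linear.has_derivative[OF assms(1) smooth_on_derivative[OF assms(2,3)]]]
  by metis

lemma linear_D: "smooth_on g U \<Longrightarrow> u \<in> U \<Longrightarrow> linear (D g u)"
  using linear_frechet_derivative smooth_on_derivative differentiableI by metis

lemma D_plane:
  fixes g :: "real \<times> real \<Rightarrow> 'b::real_normed_vector"
  assumes "smooth_on g U" "u \<in> U"
  shows "D g u v = fst v *\<^sub>R D g u (1, 0) + snd v *\<^sub>R D g u (0, 1)"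
proof -
  have "v = fst v *\<^sub>R (1, 0) + snd v *\<^sub>R (0, 1)" by (cases v) simp
  then show ?thesis
    using linear_add[OF linear_D[OF assms]] linear_scale[OF linear_D[OF assms]] by metis
qed

text \<open>The group enters only through the invariance of the image under $\theta \mapsto \theta + t$,
  expressed in the coordinates of the basis.\<close>

locale parabolic_surface =
  fixes f :: "real \<times> real \<Rightarrow> real^4" and U b0 b1 b2 b3
  assumes surf: "surface_in_hyp3 f U"
    and basis: "pseudo_orthonormal b0 b1 b2 b3"
    and neg: "u \<in> U \<Longrightarrow> mink (f u) b0 < 0"
    and invariant: "u \<in> U \<Longrightarrow> \<exists>u'\<in>U. mink (f u') b0 = mink (f u) b0 \<and>
       mink (f u') b2 = mink (f u) b2 - t * mink (f u) b0 \<and> mink (f u') b3 = mink (f u) b3"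
begin

text \<open>The functions \<open>th\<close>, \<open>ps\<close> and \<open>1 / r\<close> are the upper half-space coordinates of the surface.\<close>

definition r where "r u = - mink (f u) b0"
definition th where "th u = mink (f u) b2 / r u"
definition ps where "ps u = mink (f u) b3 / r u"

text \<open>The coordinate directions $\partial_\theta$, $\partial_\psi$ and $\partial_r$ of the half-space
  model, normalised to unit length at \<open>f u\<close>.\<close>

definition E1 where "E1 u = th u *\<^sub>R b0 + b2"
definition E2 where "E2 u = ps u *\<^sub>R b0 + b3"
definition E3 where "E3 u = f u - (1 / r u) *\<^sub>R b0"

lemma openU: "open U" and connU: "connected U" and neU: "U \<noteq> {}" and smooth_f: "smooth_on f U"
  and f_hyp3: "u \<in> U \<Longrightarrow> f u \<in> hyp3" and imm: "u \<in> U \<Longrightarrow> inj (D f u)"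
  using surf by (auto simp: surface_in_hyp3_def)

lemma r_pos: "u \<in> U \<Longrightarrow> r u > 0"
  using neg by (simp add: r_def)

lemma smooth_mink: "smooth_on (\<lambda>u. mink (f u) b) U"
  by (rule smooth_on_linear[OF openU mink.bounded_linear_left smooth_f])

lemma D_mink: "u \<in> U \<Longrightarrow> D (\<lambda>u. mink (f u) b) u v = mink (D f u v) b"
  by (rule D_linear[OF mink.bounded_linear_left smooth_f])

lemma smooth_r: "smooth_on r U"
  using smooth_mink[of "- b0"] by (simp add: r_def[abs_def] mink.minus_right)

lemma smooth_th: "smooth_on th U"
  unfolding th_def[abs_def] using r_pos by (intro smooth_on_divide openU smooth_mink smooth_r) force

lemma smooth_ps: "smooth_on ps U"
  unfolding ps_def[abs_def] using r_pos by (intro smooth_on_divide openU smooth_mink smooth_r) force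

lemmas linD = linear_D[OF smooth_r] linear_D[OF smooth_th] linear_D[OF smooth_ps] linear_D[OF smooth_f]

lemma f_coords:
  assumes "u \<in> U"
  shows "mink (f u) b0 = - r u" "mink (f u) b2 = r u * th u" "mink (f u) b3 = r u * ps u"
    "mink (f u) (f u) = - 1" "mink b0 (f u) = - r u" "mink b2 (f u) = r u * th u"
    "mink b3 (f u) = r u * ps u"
  using r_pos[OF assms] f_hyp3[OF assms]
  by (auto simp: r_def th_def ps_def hyp3_def mink_commute[of b0] mink_commute[of b2] mink_commute[of b3])

lemma df_coords:
  assumes u: "u \<in> U"
  shows "mink (D f u v) b0 = - D r u v" "mink (D f u v) b2 = r u * D th u v + D r u v * th u"
    "mink (D f u v) b3 = r u * D ps u v + D r u v * ps u" "mink (D f u v) (f u) = 0"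
proof -
  have "D (\<lambda>x. mink (f x) (- b0)) u v = mink (D f u v) (- b0)" by (rule D_mink[OF u])
  then show "mink (D f u v) b0 = - D r u v"
    by (simp add: r_def[abs_def] mink.minus_right)
  have "D (\<lambda>x. r x * th x) u v = mink (D f u v) b2"
    unfolding D_mink[OF u, symmetric]
    by (rule D_cong[OF openU u _ smooth_on_mult[OF openU smooth_r smooth_th]]) (simp add: f_coords)
  then show "mink (D f u v) b2 = r u * D th u v + D r u v * th u"
    using D_mult[OF smooth_r smooth_th u] by simp
  have "D (\<lambda>x. r x * ps x) u v = mink (D f u v) b3"
    unfolding D_mink[OF u, symmetric]
    by (rule D_cong[OF openU u _ smooth_on_mult[OF openU smooth_r smooth_ps]]) (simp add: f_coords)
  then show "mink (D f u v) b3 = r u * D ps u v + D r u v * ps u"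
    using D_mult[OF smooth_r smooth_ps u] by simp
  have d: "((\<lambda>x. mink (f x) (f x)) has_derivative (\<lambda>v. mink (f u) (D f u v) + mink (D f u v) (f u))) (at u)"
    by (intro mink.FDERIV smooth_on_derivative[OF smooth_f u])
  have "((\<lambda>x. - 1) has_derivative (\<lambda>v. mink (f u) (D f u v) + mink (D f u v) (f u))) (at u)"
    by (rule has_derivative_transform_within_open[OF d openU u]) (simp add: f_coords(4))
  from has_derivative_unique[OF this has_derivative_const]
  have "mink (f u) (D f u v) + mink (D f u v) (f u) = 0" by meson
  then show "mink (D f u v) (f u) = 0"
    using mink_commute[of "f u" "D f u v"] by linarith
qed

lemma frame_orthonormal:
  assumes "u \<in> U"
  shows "mink (E1 u) (E1 u) = 1" "mink (E2 u) (E2 u) = 1" "mink (E3 u) (E3 u) = 1"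
    "mink (E1 u) (E2 u) = 0" "mink (E1 u) (E3 u) = 0" "mink (E2 u) (E3 u) = 0"
    "mink (E2 u) (E1 u) = 0" "mink (E3 u) (E1 u) = 0" "mink (E3 u) (E2 u) = 0"
    "mink (E1 u) (f u) = 0" "mink (E2 u) (f u) = 0" "mink (E3 u) (f u) = 0"
  using r_pos[OF assms] unfolding E1_def E2_def E3_def
  by (simp_all add: mink_bilinear_simps pseudo_orthonormal_simps[OF basis] f_coords[OF assms]
      field_simps)

text \<open>The position vector and the frame span Minkowski space, because \<open>b0\<close> is a multiple of
  \<open>f u - E3 u\<close>.\<close>

lemma frame_complete:
  assumes u: "u \<in> U" and "mink y (f u) = 0" "mink y (E1 u) = 0" "mink y (E2 u) = 0" "mink y (E3 u) = 0"
  shows "y = 0"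
proof -
  have r: "r u > 0" using r_pos[OF u] .
  have y0: "mink y b0 = 0"
    using assms(2,5) r by (simp add: E3_def mink_bilinear_simps)
  then have "mink y b2 = 0" "mink y b3 = 0"
    using assms(3,4) by (simp_all add: E1_def E2_def mink_bilinear_simps)
  then have y: "y = (- mink y b1) *\<^sub>R b0"
    using pseudo_orthonormal_expansion[OF basis, of y] y0 by simp
  have "0 = - mink y b1 * mink (f u) b0"
    using assms(2) by (subst (asm) y) (simp add: mink_bilinear_simps mink_commute)
  then have "mink y b1 = 0" using f_coords(1)[OF u] r by simp
  then show ?thesis using y by simp
qed

lemma frame_expansion:
  assumes u: "u \<in> U" and y: "mink y (f u) = 0"
  shows "y = mink y (E1 u) *\<^sub>R E1 u + mink y (E2 u) *\<^sub>R E2 u + mink y (E3 u) *\<^sub>R E3 u"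
proof -
  have "y - (mink y (E1 u) *\<^sub>R E1 u + mink y (E2 u) *\<^sub>R E2 u + mink y (E3 u) *\<^sub>R E3 u) = 0"
    by (rule frame_complete[OF u]) (simp_all add: mink_bilinear_simps frame_orthonormal[OF u] y)
  then show ?thesis by simp
qed

lemma df_frame:
  assumes u: "u \<in> U"
  shows "D f u v = (r u * D th u v) *\<^sub>R E1 u + (r u * D ps u v) *\<^sub>R E2 u + (D r u v / r u) *\<^sub>R E3 u"
proof -
  have "mink (D f u v) (E1 u) = r u * D th u v" "mink (D f u v) (E2 u) = r u * D ps u v"
    "mink (D f u v) (E3 u) = D r u v / r u"
    unfolding E1_def E2_def E3_def by (simp_all add: mink_bilinear_simps df_coords[OF u])
  then show ?thesis using frame_expansion[OF u df_coords(4)[OF u]] by metis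
qed

lemma first_form:
  assumes u: "u \<in> U"
  shows "fund_form1 f u v w = (r u)\<^sup>2 * D th u v * D th u w + (r u)\<^sup>2 * D ps u v * D ps u w
     + D r u v * D r u w / (r u)\<^sup>2"
  unfolding fund_form1_def df_frame[OF u]
  by (simp add: mink_bilinear_simps frame_orthonormal[OF u] power2_eq_square)

lemma immersed:
  assumes u: "u \<in> U" and "D th u v = 0" "D ps u v = 0" "D r u v = 0"
  shows "v = 0"
proof -
  have "D f u v = 0" unfolding df_frame[OF u] using assms by simp
  then show ?thesis
    using imm[OF u] linear_injective_0[OF linD(4)[OF u]] by blast
qed

lemma invariant_coords:
  assumes u: "u \<in> U"
  obtains u' where "u' \<in> U" "r u' = r u" "ps u' = ps u" "th u' = t"
proof -
  obtain u' where u': "u' \<in> U" "mink (f u') b0 = mink (f u) b0"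
    "mink (f u') b2 = mink (f u) b2 - (t - th u) * mink (f u) b0" "mink (f u') b3 = mink (f u) b3"
    using invariant[OF u] by blast
  have r: "r u' = r u" and "ps u' = ps u" using u' by (simp_all add: r_def ps_def)
  moreover have "th u' = t"
    using u'(3) r_pos[OF u] unfolding th_def[of u'] r by (simp add: f_coords[OF u] field_simps)
  ultimately show thesis using that u'(1) by blast
qed

text \<open>If $d\psi$ and $dr$ were independent at a point, $(\psi, r)$ would be an open map there. By
  invariance, the image of \<open>U\<close> under $(\theta, \psi, r)$ would contain a product of the real line with
  an open set, although it is the image of a plane region under a differentiable map.\<close>

lemma rank_one:
  assumes u: "u \<in> U"
  shows "D ps u v * D r u w = D ps u w * D r u v"
proof (rule ccontr)
  assume ne: "D ps u v * D r u w \<noteq> D ps u w * D r u v"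
  define d where "d = D ps u v * D r u w - D ps u w * D r u v"
  have d: "d \<noteq> 0" using ne by (simp add: d_def)
  define G where "G = (\<lambda>u. (ps u, r u))"
  define F where "F = (\<lambda>u. (th u, G u))"
  have dG: "(G has_derivative (\<lambda>v. (D ps x v, D r x v))) (at x)" if "x \<in> U" for x
    unfolding G_def by (intro has_derivative_Pair smooth_on_derivative[OF smooth_ps that]
        smooth_on_derivative[OF smooth_r that])
  have dF: "(F has_derivative (\<lambda>v. (D th x v, (D ps x v, D r x v)))) (at x)" if "x \<in> U" for x
    unfolding F_def by (intro has_derivative_Pair dG smooth_on_derivative[OF smooth_th] that)
  \<comment> \<open>Cramer's rule for the inverse of the differential on the span of \<open>v\<close> and \<open>w\<close>.\<close>
  define g' where "g' = (\<lambda>z. ((fst z * D r u w - snd z * D ps u w) / d) *\<^sub>R v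
     + ((snd z * D ps u v - fst z * D r u v) / d) *\<^sub>R w)"
  have "linear g'"
    unfolding g'_def by (rule linearI) (simp_all add: algebra_simps add_divide_distrib diff_divide_distrib)
  then have "bounded_linear g'" by (simp add: linear_conv_bounded_linear)
  moreover have "(\<lambda>v. (D ps u v, D r u v)) \<circ> g' = id"
  proof
    fix z
    have "D ps u (g' z) = ((fst z * D r u w - snd z * D ps u w) * D ps u v
        + (snd z * D ps u v - fst z * D r u v) * D ps u w) / d"
      "D r u (g' z) = ((fst z * D r u w - snd z * D ps u w) * D r u v
        + (snd z * D ps u v - fst z * D r u v) * D r u w) / d"
      unfolding g'_def
      by (simp_all add: linear_add[OF linD(3)[OF u]] linear_add[OF linD(1)[OF u]]
          linear_scale[OF linD(3)[OF u]] linear_scale[OF linD(1)[OF u]] add_divide_distrib)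
    moreover have "(fst z * D r u w - snd z * D ps u w) * D ps u v
        + (snd z * D ps u v - fst z * D r u v) * D ps u w = fst z * d"
      "(fst z * D r u w - snd z * D ps u w) * D r u v
        + (snd z * D ps u v - fst z * D r u v) * D r u w = snd z * d"
      by (simp_all add: d_def algebra_simps)
    ultimately have "D ps u (g' z) = fst z" "D r u (g' z) = snd z"
      using d by simp_all
    then show "((\<lambda>v. (D ps u v, D r u v)) \<circ> g') z = id z" by simp
  qed
  moreover have "continuous_on U G"
    unfolding G_def by (intro continuous_on_Pair smooth_on_continuous smooth_ps smooth_r)
  ultimately have int: "G u \<in> interior (G ` U)"
    using sussmann_open_mapping[OF openU _ u dG[OF u]] openU u by (simp add: interior_open)
  have "UNIV \<times> interior (G ` U) \<subseteq> F ` U"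
  proof clarify
    fix t a b assume "(a, b) \<in> interior (G ` U)"
    then obtain x where x: "x \<in> U" "(a, b) = G x" using interior_subset by blast
    obtain x' where x': "x' \<in> U" "r x' = r x" "ps x' = ps x" "th x' = t"
      by (rule invariant_coords[OF x(1)])
    then have "(t, a, b) = F x'" using x by (simp add: F_def G_def)
    then show "(t, a, b) \<in> F ` U" using x' by blast
  qed
  moreover have "negligible (F ` U)"
  proof (rule negligible_differentiable_image_lowdim)
    show "DIM(real \<times> real) < DIM(real \<times> real \<times> real)" by simp
    show "F differentiable_on U"
      using dF unfolding differentiable_on_def
      by (meson differentiableI differentiable_at_withinI)
  qed
  ultimately have "negligible ((UNIV::real set) \<times> interior (G ` U))"
    using negligible_subset by blast
  moreover have "open ((UNIV::real set) \<times> interior (G ` U))" by (intro open_Times) auto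
  moreover have "(UNIV::real set) \<times> interior (G ` U) \<noteq> {}" using int by auto
  ultimately show False using open_not_negligible by blast
qed

lemma rotation_direction:
  assumes u: "u \<in> U"
  obtains e where "D ps u e = 0" "D r u e = 0" "D th u e \<noteq> 0"
proof -
  note direction = that
  have key: thesis if "e \<noteq> 0" "D ps u e = 0" "D r u e = 0" for e
    using that immersed[OF u, of e] direction[of e] by blast
  note P = D_plane[OF smooth_ps u] and R = D_plane[OF smooth_r u]
  note rk = rank_one[OF u, of "(1, 0)" "(0, 1)"]
  show thesis
  proof (cases "D ps u (1, 0) = 0 \<and> D ps u (0, 1) = 0")
    case False
    then show thesis
      using rk by (intro key[of "(D ps u (0, 1), - D ps u (1, 0))"])
        (auto simp: P[of "(D ps u (0, 1), - D ps u (1, 0))"] R[of "(D ps u (0, 1), - D ps u (1, 0))"] zero_prod_def)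
  next
    case ps: True
    show thesis
    proof (cases "D r u (1, 0) = 0 \<and> D r u (0, 1) = 0")
      case False
      then show thesis
        using ps by (intro key[of "(D r u (0, 1), - D r u (1, 0))"])
          (auto simp: P[of "(D r u (0, 1), - D r u (1, 0))"] R[of "(D r u (0, 1), - D r u (1, 0))"] zero_prod_def)
    next
      case True
      then show thesis using ps by (intro key[of "(1, 0)"]) (auto simp: zero_prod_def)
    qed
  qed
qed

lemma profile_direction:
  assumes u: "u \<in> U"
  obtains v where "D ps u v \<noteq> 0 \<or> D r u v \<noteq> 0"
proof (rule ccontr)
  assume "\<not> thesis"
  then have z: "D ps u v = 0" "D r u v = 0" for v using that by blast+
  let ?v = "(D th u (0, 1), - D th u (1, 0))"
  have "D th u ?v = 0" using D_plane[OF smooth_th u, of ?v] by simp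
  then have "?v = 0" using immersed[OF u] z by blast
  then have "D th u (1, 0) = 0" by (simp add: zero_prod_def)
  then have "(1::real, 0::real) = 0" using immersed[OF u] z by blast
  then show False by (simp add: zero_prod_def)
qed

definition is_normal where
  "is_normal u n \<longleftrightarrow> mink n n = 1 \<and> mink n (f u) = 0 \<and> (\<forall>v. mink n (D f u v) = 0) \<and>
     det (vector [f u, D f u (1, 0), D f u (0, 1), n] :: real^4^4) > 0"

text \<open>The vector \<open>p E2 + q E3\<close> completes the position vector and the tangent plane to a spanning
  set: the tangent plane contains \<open>E1\<close> and a nonzero vector orthogonal to \<open>p E2 + q E3\<close> in the
  plane of \<open>E2\<close> and \<open>E3\<close>.\<close>

lemma tangent_complete:
  assumes u: "u \<in> U" and p: "p\<^sup>2 + q\<^sup>2 = 1" "\<And>v. p * (r u * D ps u v) + q * (D r u v / r u) = 0"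
    and y: "mink y (f u) = 0" "\<And>v. mink y (D f u v) = 0" "mink y (p *\<^sub>R E2 u + q *\<^sub>R E3 u) = 0"
  shows "y = 0"
proof (rule frame_complete[OF u y(1)])
  have r: "r u > 0" using r_pos[OF u] .
  obtain e where e: "D ps u e = 0" "D r u e = 0" "D th u e \<noteq> 0" by (rule rotation_direction[OF u])
  show "mink y (E1 u) = 0"
    using y(2)[of e] e r unfolding df_frame[OF u] by (simp add: mink_bilinear_simps)
  then have t: "(r u * D ps u v) * mink y (E2 u) + (D r u v / r u) * mink y (E3 u) = 0" for v
    using y(2)[of v] unfolding df_frame[OF u] by (simp add: mink_bilinear_simps)
  obtain v where v: "D ps u v \<noteq> 0 \<or> D r u v \<noteq> 0" by (rule profile_direction[OF u])
  define a b Y Z where "a = r u * D ps u v" and "b = D r u v / r u"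
    and "Y = mink y (E2 u)" and "Z = mink y (E3 u)"
  have ab: "a \<noteq> 0 \<or> b \<noteq> 0" using v r by (auto simp: a_def b_def)
  have eqs: "a * Y + b * Z = 0" "p * a + q * b = 0" "p * Y + q * Z = 0"
    using t[of v] p(2)[of v] y(3) by (simp_all add: a_def b_def Y_def Z_def mink_bilinear_simps)
  have "a * (Y * q - Z * p) = 0 \<and> b * (Y * q - Z * p) = 0"
  proof
    have "a * (Y * q - Z * p) = q * (a * Y + b * Z) - Z * (p * a + q * b)"
      by (simp add: algebra_simps)
    then show "a * (Y * q - Z * p) = 0" by (simp add: eqs)
    have "b * (Y * q - Z * p) = Y * (p * a + q * b) - p * (a * Y + b * Z)"
      by (simp add: algebra_simps)
    then show "b * (Y * q - Z * p) = 0" by (simp add: eqs)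
  qed
  then have c: "Y * q - Z * p = 0" using ab by auto
  have "(p\<^sup>2 + q\<^sup>2) * Y = p * (p * Y + q * Z) + q * (Y * q - Z * p)"
    "(p\<^sup>2 + q\<^sup>2) * Z = q * (p * Y + q * Z) - p * (Y * q - Z * p)"
    by (simp_all add: algebra_simps power2_eq_square)
  then show "mink y (E2 u) = 0" "mink y (E3 u) = 0"
    unfolding eqs(3) c p(1) by (simp_all add: Y_def Z_def)
qed

text \<open>The normal is orthogonal to the rotation direction \<open>E1\<close>, so it is obtained by a quarter turn
  from the tangent of the profile in the plane of \<open>E2\<close> and \<open>E3\<close>, up to the sign prescribed by the
  determinant.\<close>

lemma unit_normal_frame:
  assumes u: "u \<in> U"
  obtains p q where "unit_normal f u = p *\<^sub>R E2 u + q *\<^sub>R E3 u" "p\<^sup>2 + q\<^sup>2 = 1"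
    "\<And>v. p * (r u * D ps u v) + q * (D r u v / r u) = 0" "is_normal u (unit_normal f u)"
proof -
  have r: "r u > 0" using r_pos[OF u] .
  obtain v where v: "D ps u v \<noteq> 0 \<or> D r u v \<noteq> 0" by (rule profile_direction[OF u])
  define a b where "a = r u * D ps u v" and "b = D r u v / r u"
  define N where "N = sqrt (a\<^sup>2 + b\<^sup>2)"
  have ab: "a\<^sup>2 + b\<^sup>2 > 0" using v r by (auto simp: a_def b_def sum_power2_gt_zero_iff)
  then have N: "N > 0" "N\<^sup>2 = a\<^sup>2 + b\<^sup>2" by (simp_all add: N_def)
  define p q where "p = - b / N" and "q = a / N"
  have "p\<^sup>2 + q\<^sup>2 = (a\<^sup>2 + b\<^sup>2) / N\<^sup>2"
    by (simp add: p_def q_def power_divide add_divide_distrib)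
  then have pq: "p\<^sup>2 + q\<^sup>2 = 1"
    unfolding N(2) using ab by (metis divide_self less_irrefl)
  have tan: "p * (r u * D ps u w) + q * (D r u w / r u) = 0" for w
    using rank_one[OF u, of v w] r N by (simp add: p_def q_def a_def b_def field_simps)
  define n where "n = p *\<^sub>R E2 u + q *\<^sub>R E3 u"
  have n: "mink n n = 1" "mink n (f u) = 0" "mink n (D f u w) = 0" for w
    unfolding n_def df_frame[OF u] using pq tan[of w]
    by (simp_all add: mink_bilinear_simps frame_orthonormal[OF u] power2_eq_square mult.commute)
  define d where "d = det (vector [f u, D f u (1, 0), D f u (0, 1), n] :: real^4^4)"
  have complete: "y = 0" if "mink y (f u) = 0" "\<And>v. mink y (D f u v) = 0" "mink y n = 0" for y
    using tangent_complete[OF u pq tan that(1,2)] that(3) unfolding n_def by blast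
  have "d \<noteq> 0" unfolding d_def
  proof (rule det_vector_nonzero)
    fix y assume y: "mink y (f u) = 0" "mink y (D f u (1, 0)) = 0" "mink y (D f u (0, 1)) = 0" "mink y n = 0"
    have "mink y (D f u w) = 0" for w
      using y by (subst D_plane[OF smooth_f u]) (simp add: mink_bilinear_simps)
    then show "y = 0" using complete y by blast
  qed
  define k where "k = sgn d"
  have k: "k * k = 1" "k * d > 0" using \<open>d \<noteq> 0\<close> by (auto simp: k_def sgn_if)
  have nor: "is_normal u (k *\<^sub>R n)"
    using k n unfolding is_normal_def
    by (simp add: mink_bilinear_simps det_vector_scale_last d_def[symmetric])
  have "n' = k *\<^sub>R n" if "is_normal u n'" for n'
  proof -
    have n': "mink n' n' = 1" "mink n' (f u) = 0" "\<And>v. mink n' (D f u v) = 0"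
      "det (vector [f u, D f u (1, 0), D f u (0, 1), n'] :: real^4^4) > 0"
      using that by (auto simp: is_normal_def)
    define l where "l = mink n' n"
    have "n' - l *\<^sub>R n = 0"
      by (rule complete) (simp_all add: mink_bilinear_simps n n' l_def)
    then have eq: "n' = l *\<^sub>R n" by simp
    then have "l * l = 1" using n' n by (simp add: mink_bilinear_simps)
    moreover have "l * d > 0" using n'(4) unfolding eq by (simp add: det_vector_scale_last d_def)
    ultimately have "l = k" using k \<open>d \<noteq> 0\<close>
      by (smt (verit) mult_minus_left mult_cancel_right square_eq_iff)
    then show ?thesis using eq by simp
  qed
  with nor have "(THE n. is_normal u n) = k *\<^sub>R n" by (rule the_equality)
  then have un: "unit_normal f u = k *\<^sub>R n"
    unfolding unit_normal_def is_normal_def .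
  show thesis
  proof (rule that[of "k * p" "k * q"])
    show "unit_normal f u = (k * p) *\<^sub>R E2 u + (k * q) *\<^sub>R E3 u"
      unfolding un n_def by (simp add: scaleR_add_right)
    have "(k * p)\<^sup>2 + (k * q)\<^sup>2 = k * k * (p\<^sup>2 + q\<^sup>2)"
      by (simp add: power2_eq_square algebra_simps)
    then show "(k * p)\<^sup>2 + (k * q)\<^sup>2 = 1" by (simp add: pq k(1))
    show "k * p * (r u * D ps u w) + k * q * (D r u w / r u) = 0" for w
      using tan[of w] by (metis (no_types) distrib_left mult.assoc mult_zero_right)
    show "is_normal u (unit_normal f u)" unfolding un by (rule nor)
  qed
qed

text \<open>The normal is a combination of \<open>b0\<close>, \<open>b3\<close> and the position vector. The second derivative of
  \<open>f\<close> pairs with the constant vectors through the second derivatives of the coordinates, and with the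
  position vector through the first fundamental form, since $(df, f) = 0$.\<close>

lemma second_form:
  assumes u: "u \<in> U" and n: "unit_normal f u = p *\<^sub>R E2 u + q *\<^sub>R E3 u"
  shows "fund_form2 f u v w =
    p * (r u * D (\<lambda>x. D ps x v) u w + D r u w * D ps u v + D ps u w * D r u v)
    + q * (D (\<lambda>x. D r x v) u w / r u - fund_form1 f u v w)"
proof -
  let ?Y = "D (\<lambda>x. D f x v) u w"
  have smooth: "smooth_on (\<lambda>x. D f x v) U" "smooth_on (\<lambda>x. D r x v) U" "smooth_on (\<lambda>x. D ps x v) U"
    using smooth_on_frechet smooth_f smooth_r smooth_ps by blast+
  have smoothY: "smooth_on (\<lambda>x. mink (D f x v) b) U" for b
    by (rule smooth_on_linear[OF openU mink.bounded_linear_left smooth(1)])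
  have DY: "D (\<lambda>x. mink (D f x v) b) u w = mink ?Y b" for b
    by (rule D_linear[OF mink.bounded_linear_left smooth(1) u])
  have 0: "mink ?Y b0 = - D (\<lambda>x. D r x v) u w"
  proof -
    have "D (\<lambda>x. mink (D f x v) (- b0)) u w = D (\<lambda>x. D r x v) u w"
      by (rule D_cong[OF openU u _ smoothY]) (simp add: df_coords mink.minus_right)
    then show ?thesis unfolding DY by (simp add: mink.minus_right)
  qed
  have 3: "mink ?Y b3 = r u * D (\<lambda>x. D ps x v) u w + D r u w * D ps u v + D r u v * D ps u w
      + D (\<lambda>x. D r x v) u w * ps u"
  proof -
    have "D (\<lambda>x. mink (D f x v) b3) u w = D (\<lambda>x. r x * D ps x v + D r x v * ps x) u w"
      by (rule D_cong[OF openU u _ smoothY]) (simp add: df_coords)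
    also have "\<dots> = D (\<lambda>x. r x * D ps x v) u w + D (\<lambda>x. D r x v * ps x) u w"
      by (rule D_add[OF _ _ u]) (intro smooth_on_mult openU smooth smooth_r smooth_ps)+
    also have "\<dots> = r u * D (\<lambda>x. D ps x v) u w + D r u w * D ps u v + (D r u v * D ps u w
      + D (\<lambda>x. D r x v) u w * ps u)"
      by (simp add: D_mult[OF smooth_r smooth(3) u] D_mult[OF smooth(2) smooth_ps u])
    finally show ?thesis unfolding DY by simp
  qed
  have F: "mink ?Y (f u) = - fund_form1 f u v w"
  proof -
    have d: "((\<lambda>x. mink (D f x v) (f x)) has_derivative (\<lambda>w. mink (D f u v) (D f u w) + mink (D (\<lambda>x. D f x v) u w) (f u))) (at u)"
      by (intro mink.FDERIV smooth_on_derivative[OF smooth_f u] smooth_on_derivative[OF smooth(1) u])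
    have "((\<lambda>x. 0) has_derivative (\<lambda>w. mink (D f u v) (D f u w) + mink (D (\<lambda>x. D f x v) u w) (f u))) (at u)"
      by (rule has_derivative_transform_within_open[OF d openU u]) (simp add: df_coords(4))
    from has_derivative_unique[OF this has_derivative_const]
    have "mink (D f u v) (D f u w) + mink ?Y (f u) = 0" by meson
    then show ?thesis by (simp add: fund_form1_def)
  qed
  show ?thesis
    unfolding fund_form2_def n E2_def E3_def
    by (simp add: mink_bilinear_simps 0 3 F algebra_simps)
qed

end

section \<open>The principal curvatures\<close>

text \<open>In the plane, the orthogonal complement \<open>g\<close> of a principal direction \<open>e\<close> is principal as well.
  The remaining principal curvature is therefore the quotient of \<open>II g g\<close> by \<open>I g g\<close>.\<close>

lemma principal_curvatures_pair:
  fixes I II :: "real \<times> real \<Rightarrow> real \<times> real \<Rightarrow> real"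
  assumes bI: "bilinear I" and bII: "bilinear II"
    and sI: "\<And>v w. I v w = I w v" and sII: "\<And>v w. II v w = II w v"
    and pos: "\<And>v. v \<noteq> 0 \<Longrightarrow> I v v > 0"
    and e: "e \<noteq> 0" "\<And>w. II e w = k0 * I e w"
  shows "\<exists>g k1. g \<noteq> 0 \<and> I e g = 0 \<and> II g g = k1 * I g g \<and>
    {k. \<exists>v. v \<noteq> 0 \<and> (\<forall>w. II v w = k * I v w)} = {k0, k1} \<and>
    (\<forall>v. \<exists>a b. v = a *\<^sub>R e + b *\<^sub>R g)"
proof -
  note lI = bilinear_ladd[OF bI] bilinear_radd[OF bI] bilinear_lmul[OF bI] bilinear_rmul[OF bI]
    bilinear_lsub[OF bI] bilinear_rsub[OF bI] bilinear_lzero[OF bI]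
  note lII = bilinear_ladd[OF bII] bilinear_radd[OF bII] bilinear_lmul[OF bII] bilinear_rmul[OF bII]
  have plane: "v = fst v *\<^sub>R (1, 0) + snd v *\<^sub>R (0, 1)" for v :: "real \<times> real" by (cases v) simp
  define x y where "x = I e (1, 0)" and "y = I e (0, 1)"
  have Ie: "I e v = fst v * x + snd v * y" for v
    by (subst plane[of v]) (simp only: lI real_scaleR_def x_def y_def)
  define g where "g = (- y, x)"
  have xy: "x \<noteq> 0 \<or> y \<noteq> 0" using pos[OF e(1)] Ie[of e] by auto
  then have g: "g \<noteq> 0" "I e g = 0" by (auto simp: g_def zero_prod_def Ie)
  have span: "v = (I v e / I e e) *\<^sub>R e + (I v g / I g g) *\<^sub>R g" for v
  proof -
    define z where "z = v - ((I v e / I e e) *\<^sub>R e + (I v g / I g g) *\<^sub>R g)"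
    have z: "I e z = 0" "I z g = 0"
      using pos[OF e(1)] pos[OF g(1)] g(2)
      by (simp_all add: z_def lI sI[of e v] sI[of g e])
    have "\<exists>t. z = t *\<^sub>R g"
    proof (cases "x = 0")
      case True
      then show ?thesis using z(1) xy unfolding Ie
        by (intro exI[of _ "- fst z / y"]) (auto simp: g_def prod_eq_iff)
    next
      case False
      then show ?thesis using z(1) unfolding Ie
        by (intro exI[of _ "snd z / x"]) (auto simp: g_def prod_eq_iff field_simps)
    qed
    then obtain t where t: "z = t *\<^sub>R g" ..
    then have "t * I g g = 0" using z(2) by (simp add: lI)
    then have "t = 0" using pos[OF g(1)] by simp
    then show ?thesis using t by (simp add: z_def)
  qed
  define k1 where "k1 = II g g / I g g"
  have gg: "II g g = k1 * I g g" using pos[OF g(1)] by (simp add: k1_def)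
  have eg: "II e g = 0" "II g e = 0" "I g e = 0" using e(2)[of g] g(2) sII[of e g] sI[of g e] by simp_all
  have IIg: "II g w = k1 * I g w" for w
  proof -
    obtain a b where w: "w = a *\<^sub>R e + b *\<^sub>R g" using span by blast
    show ?thesis unfolding w by (simp add: lI lII eg gg)
  qed
  have "k = k0 \<or> k = k1" if v: "v \<noteq> 0" "\<And>w. II v w = k * I v w" for k v
  proof -
    obtain a b where ab: "v = a *\<^sub>R e + b *\<^sub>R g" using span by blast
    have "a * (k0 * I e e) = k * (a * I e e)" "b * (k1 * I g g) = k * (b * I g g)"
      using v(2)[of e] v(2)[of g] unfolding ab by (simp_all add: lI lII eg gg g(2) e(2))
    then have "a * (k0 - k) = 0" "b * (k1 - k) = 0"
      using pos[OF e(1)] pos[OF g(1)] by (simp_all add: algebra_simps)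
    moreover have "a \<noteq> 0 \<or> b \<noteq> 0" using v(1) ab by auto
    ultimately show ?thesis by auto
  qed
  then have "{k. \<exists>v. v \<noteq> 0 \<and> (\<forall>w. II v w = k * I v w)} = {k0, k1}"
    using e g(1) IIg by blast
  then show ?thesis using g gg span by (intro exI[of _ g] exI[of _ k1]) blast
qed

context parabolic_surface
begin

lemma bilinear_first_form: "u \<in> U \<Longrightarrow> bilinear (fund_form1 f u)"
  unfolding bilinear_def fund_form1_def
  by (intro conjI allI linearI)
     (simp_all add: linear_add[OF linD(4)] linear_scale[OF linD(4)] mink_bilinear_simps)

lemma first_form_symmetric: "fund_form1 f u v w = fund_form1 f u w v"
  by (simp add: fund_form1_def mink_commute)

lemma first_form_pos:
  assumes u: "u \<in> U" and v: "v \<noteq> 0"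
  shows "fund_form1 f u v v > 0"
proof -
  have r: "r u > 0" using r_pos[OF u] .
  have eq: "fund_form1 f u v v = (r u * D th u v)\<^sup>2 + (r u * D ps u v)\<^sup>2 + (D r u v / r u)\<^sup>2"
    unfolding first_form[OF u] by (simp add: power2_eq_square)
  have "fund_form1 f u v v \<noteq> 0"
  proof
    assume "fund_form1 f u v v = 0"
    then have "(r u * D th u v)\<^sup>2 = 0" "(r u * D ps u v)\<^sup>2 = 0" "(D r u v / r u)\<^sup>2 = 0"
      unfolding eq by (smt (verit) zero_le_power2)+
    then show False using immersed[OF u, of v] v r by simp
  qed
  moreover have "fund_form1 f u v v \<ge> 0" unfolding eq by simp
  ultimately show ?thesis by simp
qed

lemma second_form_symmetric:
  assumes u: "u \<in> U"
  shows "fund_form2 f u v w = fund_form2 f u w v"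
proof -
  obtain p q where n: "unit_normal f u = p *\<^sub>R E2 u + q *\<^sub>R E3 u"
    using unit_normal_frame[OF u] by metis
  show ?thesis
    unfolding second_form[OF u n]
      smooth_on_second_derivative_symmetric[OF openU smooth_ps u, of v w]
      smooth_on_second_derivative_symmetric[OF openU smooth_r u, of v w] first_form_symmetric[of u v w]
    by (simp add: algebra_simps)
qed

lemma bilinear_second_form:
  assumes u: "u \<in> U"
  shows "bilinear (fund_form2 f u)"
proof -
  have lin: "linear (fund_form2 f u v)" for v
  proof -
    have l: "linear (D (\<lambda>x. D f x v) u)"
      by (rule linear_D[OF smooth_on_frechet[OF smooth_f] u])
    show ?thesis unfolding fund_form2_def
      by (rule linearI) (simp_all add: linear_add[OF l] linear_scale[OF l] mink_bilinear_simps)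
  qed
  moreover have "linear (\<lambda>v. fund_form2 f u v w)" for w
    using lin[of w] unfolding second_form_symmetric[OF u, of w] .
  ultimately show ?thesis by (simp add: bilinear_def)
qed

lemma gauss_curvature_product:
  assumes u: "u \<in> U" and e: "e \<noteq> 0" "\<And>w. fund_form2 f u e w = k0 * fund_form1 f u e w"
  obtains g k1 where "g \<noteq> 0" "fund_form1 f u e g = 0" "fund_form2 f u g g = k1 * fund_form1 f u g g"
    "gauss_curvature f u = k0 * k1" "\<And>v. \<exists>a b. v = a *\<^sub>R e + b *\<^sub>R g"
proof -
  obtain g k1 where g: "g \<noteq> 0" "fund_form1 f u e g = 0" "fund_form2 f u g g = k1 * fund_form1 f u g g"
    "{k. \<exists>v. v \<noteq> 0 \<and> (\<forall>w. fund_form2 f u v w = k * fund_form1 f u v w)} = {k0, k1}"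
    "\<And>v. \<exists>a b. v = a *\<^sub>R e + b *\<^sub>R g"
    using principal_curvatures_pair[OF bilinear_first_form[OF u] bilinear_second_form[OF u]
        first_form_symmetric second_form_symmetric[OF u] first_form_pos[OF u] e]
    by blast
  have "gauss_curvature f u = k0 * k1"
    unfolding gauss_curvature_def curv1_def curv2_def principal_curvatures_def g(4)
    by (simp add: min_def max_def)
  then show thesis using that[OF g(1-3) _ g(5)] by blast
qed

text \<open>Where $d\psi = 0$ the normal is $\pm$ \<open>E2\<close>. Differentiating the relation of \<open>rank_one\<close> shows
  that the rotation direction is then principal with curvature zero.\<close>

lemma profile_graph:
  assumes u: "u \<in> U" and K: "gauss_curvature f u \<noteq> 0"
  shows "\<exists>v. D ps u v \<noteq> 0"
proof (rule ccontr)
  assume "\<not> ?thesis"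
  then have ps: "D ps u v = 0" for v by blast
  obtain p q where n: "unit_normal f u = p *\<^sub>R E2 u + q *\<^sub>R E3 u"
    "\<And>v. p * (r u * D ps u v) + q * (D r u v / r u) = 0"
    using unit_normal_frame[OF u] by metis
  obtain e where e: "D ps u e = 0" "D r u e = 0" "D th u e \<noteq> 0" by (rule rotation_direction[OF u])
  obtain v where v: "D r u v \<noteq> 0" using profile_direction[OF u] ps by metis
  have q: "q = 0" using n(2)[of v] v ps r_pos[OF u] by simp
  have psew: "D (\<lambda>x. D ps x e) u w = 0" for w
  proof -
    note smooth = smooth_on_frechet[OF smooth_ps] smooth_on_frechet[OF smooth_r]
    have "D (\<lambda>x. D ps x e * D r x v) u w = D (\<lambda>x. D ps x v * D r x e) u w"
      by (rule D_cong[OF openU u rank_one smooth_on_mult[OF openU smooth]])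
    then show ?thesis
      using v ps e by (simp add: D_mult[OF smooth u])
  qed
  have "e \<noteq> 0" using e(3) linear_0[OF linD(2)[OF u]] by auto
  moreover have "fund_form2 f u e w = 0 * fund_form1 f u e w" for w
    unfolding second_form[OF u n(1)] by (simp add: q psew ps e)
  ultimately show False using gauss_curvature_product[OF u, of e 0] K by (metis mult_zero_left)
qed

end

section \<open>Constant Gauss curvature\<close>

locale parabolic_surface_constant_curvature = parabolic_surface +
  fixes K :: real
  assumes curvature: "u \<in> U \<Longrightarrow> gauss_curvature f u = K" and K: "K \<noteq> 0"
    and not_tubular: "\<not> tubular f U"
begin

text \<open>The squared length of $d\psi$, which serves to express \<open>m\<close> by smooth functions.\<close>

definition ps_sq where "ps_sq u = D ps u (1, 0) * D ps u (1, 0) + D ps u (0, 1) * D ps u (0, 1)"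

text \<open>The slope $d(1/r)/d\psi$ of the profile, computed as the ratio of the gradients
  $-dr / r^2$ and $d\psi$, which are parallel by \<open>rank_one\<close>.\<close>

definition m where
  "m u = - 1 * (D r u (1, 0) * D ps u (1, 0) + D r u (0, 1) * D ps u (0, 1)) / (r u * r u * ps_sq u)"

lemma ps_sq_pos: assumes u: "u \<in> U" shows "ps_sq u > 0"
proof -
  obtain v where "D ps u v \<noteq> 0" using profile_graph[OF u] curvature[OF u] K by metis
  then have "D ps u (1, 0) \<noteq> 0 \<or> D ps u (0, 1) \<noteq> 0"
    using D_plane[OF smooth_ps u, of v] by auto
  then show ?thesis unfolding ps_sq_def
    by (metis not_sum_squares_lt_zero sum_squares_gt_zero_iff)
qed

lemma smooth_m: "smooth_on m U"
  unfolding m_def[abs_def] ps_sq_def[abs_def]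
proof (intro smooth_on_divide smooth_on_mult smooth_on_add smooth_on_frechet smooth_on_const
    smooth_r smooth_ps openU)
  fix u assume u: "u \<in> U"
  show "r u * r u * (D ps u (1, 0) * D ps u (1, 0) + D ps u (0, 1) * D ps u (0, 1)) \<noteq> 0"
    using ps_sq_pos[OF u] r_pos[OF u] unfolding ps_sq_def by (metis less_irrefl no_zero_divisors)
qed

lemma slope:
  assumes u: "u \<in> U"
  shows "D r u v = - 1 * (r u * (r u * (m u * D ps u v)))"
proof -
  have "D r u v * ps_sq u = (D r u (1, 0) * D ps u (1, 0) + D r u (0, 1) * D ps u (0, 1)) * D ps u v"
  proof -
    have "D r u v * ps_sq u = (D ps u (1, 0) * D r u v) * D ps u (1, 0)
        + (D ps u (0, 1) * D r u v) * D ps u (0, 1)"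
      by (simp add: ps_sq_def algebra_simps)
    also have "\<dots> = (D r u (1, 0) * D ps u (1, 0) + D r u (0, 1) * D ps u (0, 1)) * D ps u v"
      unfolding rank_one[OF u, of "(1, 0)" v] rank_one[OF u, of "(0, 1)" v]
      by (simp add: algebra_simps)
    finally show ?thesis .
  qed
  then show ?thesis
    using ps_sq_pos[OF u] r_pos[OF u] by (simp add: m_def field_simps)
qed

text \<open>Up to sign, the principal curvature of the rotation direction.\<close>

definition q where "q u = mink (unit_normal f u) (E3 u)"

lemma unit_normal_slope:
  assumes u: "u \<in> U"
  shows "unit_normal f u = (q u * m u) *\<^sub>R E2 u + q u *\<^sub>R E3 u" "(q u)\<^sup>2 * (1 + (m u)\<^sup>2) = 1"
    "is_normal u (unit_normal f u)"
proof -
  obtain p q' where n: "unit_normal f u = p *\<^sub>R E2 u + q' *\<^sub>R E3 u" "p\<^sup>2 + q'\<^sup>2 = 1"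
    "\<And>v. p * (r u * D ps u v) + q' * (D r u v / r u) = 0" "is_normal u (unit_normal f u)"
    using unit_normal_frame[OF u] by metis
  have q: "q u = q'" unfolding q_def n(1) by (simp add: mink_bilinear_simps frame_orthonormal[OF u])
  obtain v where v: "D ps u v \<noteq> 0" using profile_graph[OF u] curvature[OF u] K by metis
  have "(p - q' * m u) * (r u * D ps u v) = 0"
    using n(3)[of v] r_pos[OF u] unfolding slope[OF u] by (simp add: field_simps)
  then have "p = q u * m u" using v r_pos[OF u] q by simp
  then show "unit_normal f u = (q u * m u) *\<^sub>R E2 u + q u *\<^sub>R E3 u" "(q u)\<^sup>2 * (1 + (m u)\<^sup>2) = 1"
    "is_normal u (unit_normal f u)"
    using n q by (simp_all add: power_mult_distrib algebra_simps)
qed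

lemma second_form_slope:
  assumes u: "u \<in> U"
  shows "fund_form2 f u v w = - q u * fund_form1 f u v w - q u * r u * D ps u v * D m u w"
proof -
  have r: "r u > 0" using r_pos[OF u] .
  have smooth: "smooth_on (\<lambda>x. D ps x v) U" by (rule smooth_on_frechet[OF smooth_ps])
  note sm = smooth_on_mult[OF openU smooth_m smooth]
  have "D (\<lambda>x. D r x v) u w = D (\<lambda>x. - 1 * (r x * (r x * (m x * D ps x v)))) u w"
    by (rule D_cong[OF openU u slope smooth_on_frechet[OF smooth_r]])
  also have "\<dots> = - (r u * (r u * (m u * D (\<lambda>x. D ps x v) u w + D m u w * D ps u v)
      + D r u w * (m u * D ps u v)) + D r u w * (r u * (m u * D ps u v)))"
    by (simp only: D_mult[OF smooth_on_const[OF openU] smooth_on_mult[OF openU smooth_r smooth_on_mult[OF openU smooth_r sm]] u]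
        D_mult[OF smooth_r smooth_on_mult[OF openU smooth_r sm] u] D_mult[OF smooth_r sm u] D_mult[OF smooth_m smooth u]
        frechet_derivative_const) simp
  finally have dd: "D (\<lambda>x. D r x v) u w = - (r u * (r u * (m u * D (\<lambda>x. D ps x v) u w + D m u w * D ps u v)
      + D r u w * (m u * D ps u v)) + D r u w * (r u * (m u * D ps u v)))" .
  show ?thesis
    unfolding second_form[OF u unit_normal_slope(1)[OF u]] dd slope[OF u]
    using r by (simp add: field_simps power2_eq_square)
qed

text \<open>The form of \<open>second_form_slope\<close> shows that the rotation direction \<open>e\<close> has curvature \<open>- q\<close>, and its
  symmetry that \<open>dm\<close> vanishes on \<open>e\<close>. On the complementary principal direction \<open>g\<close>, the equation
  $K = -q k_1$ determines \<open>dm\<close>.\<close>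

lemma slope_derivative:
  assumes u: "u \<in> U"
  shows "D m u v = r u * (1 + (m u)\<^sup>2) * (K * (1 + (m u)\<^sup>2) - 1) * D ps u v"
proof -
  have r: "r u > 0" using r_pos[OF u] .
  obtain e where e: "D ps u e = 0" "D r u e = 0" "D th u e \<noteq> 0" by (rule rotation_direction[OF u])
  have e0: "e \<noteq> 0" using e(3) linear_0[OF linD(2)[OF u]] by auto
  obtain g k1 where g: "g \<noteq> 0" "fund_form1 f u e g = 0"
    "fund_form2 f u g g = k1 * fund_form1 f u g g" "gauss_curvature f u = - q u * k1"
    "\<And>v. \<exists>a b. v = a *\<^sub>R e + b *\<^sub>R g"
  proof (rule gauss_curvature_product[OF u e0])
    show "fund_form2 f u e w = - q u * fund_form1 f u e w" for w
      unfolding second_form_slope[OF u] by (simp add: e)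
  qed blast
  have q0: "q u \<noteq> 0" using unit_normal_slope(2)[OF u] by auto
  have "D th u g = 0"
    using g(2) e r unfolding first_form[OF u] by simp
  then have psg: "D ps u g \<noteq> 0"
    using immersed[OF u, of g] g(1) unfolding slope[OF u] by auto
  have Igg: "fund_form1 f u g g = (r u)\<^sup>2 * (1 + (m u)\<^sup>2) * (D ps u g)\<^sup>2"
    unfolding first_form[OF u] slope[OF u] \<open>D th u g = 0\<close>
    using r by (simp add: field_simps power2_eq_square)
  have "fund_form2 f u g e = fund_form2 f u e g" by (rule second_form_symmetric[OF u])
  then have me: "D m u e = 0"
    unfolding second_form_slope[OF u] first_form_symmetric[of u g e] using psg q0 r e by simp
  have mg: "D m u g = r u * (1 + (m u)\<^sup>2) * (K * (1 + (m u)\<^sup>2) - 1) * D ps u g"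
  proof -
    define M where "M = 1 + (m u)\<^sup>2"
    have M: "(q u)\<^sup>2 * M = 1" using unit_normal_slope(2)[OF u] by (simp add: M_def)
    have "k1 * ((r u)\<^sup>2 * M * (D ps u g)\<^sup>2) =
       - q u * ((r u)\<^sup>2 * M * (D ps u g)\<^sup>2) - q u * r u * D ps u g * D m u g"
      using g(3) unfolding second_form_slope[OF u] Igg M_def by (rule sym)
    then have "(r u * D ps u g) * (k1 * (r u * M * D ps u g)) =
       (r u * D ps u g) * (- q u * (r u * M * D ps u g) - q u * D m u g)"
      by (simp add: power2_eq_square algebra_simps)
    then have "k1 * (r u * M * D ps u g) = - q u * (r u * M * D ps u g) - q u * D m u g"
      using psg r by simp
    then have "(- q u * M) * (k1 * (r u * M * D ps u g))
        = (- q u * M) * (- q u * (r u * M * D ps u g) - q u * D m u g)"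
      by (rule arg_cong)
    then have "(- q u * k1) * (r u * M * D ps u g) * M
        = ((q u)\<^sup>2 * M) * (r u * M * D ps u g) + ((q u)\<^sup>2 * M) * D m u g"
      by (simp add: power2_eq_square algebra_simps)
    then have "K * (r u * M * D ps u g) * M = r u * M * D ps u g + D m u g"
      unfolding M using g(4) curvature[OF u] by simp
    then show ?thesis unfolding M_def[symmetric] by (simp add: algebra_simps)
  qed
  obtain a b where v: "v = a *\<^sub>R e + b *\<^sub>R g" using g(5) by blast
  note lm = linear_D[OF smooth_m u]
  have "D m u v = b * D m u g" "D ps u v = b * D ps u g"
    unfolding v by (simp_all add: linear_add[OF lm] linear_scale[OF lm] me e
        linear_add[OF linD(3)[OF u]] linear_scale[OF linD(3)[OF u]])
  then show ?thesis unfolding mg by simp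
qed

text \<open>In the half-plane with height $h = 1/r$, this expresses that the square $w$ of the cosine of the
  angle of inclination satisfies $w = K + c h^2$.\<close>

definition c where "c u = (inverse (1 + (m u)\<^sup>2) - K) * (r u)\<^sup>2"

lemma first_integral: "u \<in> U \<Longrightarrow> u' \<in> U \<Longrightarrow> c u = c u'"
proof (rule constant_if_derivative_zero[OF openU connU])
  fix u assume u: "u \<in> U"
  define M where "M = 1 + (m u)\<^sup>2"
  have M: "M > 0" unfolding M_def by (simp add: add_pos_nonneg)
  note dm = smooth_on_derivative[OF smooth_m u] and dr = smooth_on_derivative[OF smooth_r u]
  have "(c has_derivative (\<lambda>v. (inverse M - K) * (2 * D r u v * r u)
      + - (inverse M * (2 * D m u v * m u) * inverse M) * (r u)\<^sup>2)) (at u)"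
    unfolding c_def[abs_def] M_def
    using M unfolding M_def
    by (auto intro!: derivative_eq_intros dm dr simp: fun_eq_iff algebra_simps)
  moreover have "(inverse M - K) * (2 * D r u v * r u)
      + - (inverse M * (2 * D m u v * m u) * inverse M) * (r u)\<^sup>2 = 0" for v
    unfolding slope_derivative[OF u] slope[OF u] M_def[symmetric]
    using M by (simp add: field_simps power2_eq_square)
  ultimately show "(c has_derivative (\<lambda>v. 0)) (at u)" by (simp only:)
qed

text \<open>The determinant in the definition of the unit normal is \<open>q\<close> times a continuous function, and it
  is positive.\<close>

lemma normal_sign_constant:
  assumes "u \<in> U" "u' \<in> U"
  shows "q u * q u' > 0"
proof -
  define N L where "N = (\<lambda>u. m u *\<^sub>R E2 u + E3 u)"
    and "L = (\<lambda>u. det (vector [f u, D f u (1, 0), D f u (0, 1), N u] :: real^4^4))"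
  have cont: "continuous_on U r" "continuous_on U ps" "continuous_on U m" "continuous_on U f"
    "continuous_on U (\<lambda>u. D f u v)" for v
    using smooth_on_continuous smooth_r smooth_ps smooth_m smooth_f smooth_on_frechet by blast+
  have "continuous_on U N"
    unfolding N_def E2_def E3_def using cont r_pos by (intro continuous_intros) force+
  then have L: "continuous_on U L"
    unfolding L_def using cont by (intro continuous_on_det_vector)
  have pos: "q u * L u > 0" if "u \<in> U" for u
  proof -
    have "unit_normal f u = q u *\<^sub>R N u"
      using unit_normal_slope(1)[OF that] by (simp add: N_def scaleR_add_right)
    then show ?thesis
      using unit_normal_slope(3)[OF that] unfolding is_normal_def
      by (simp add: det_vector_scale_last L_def)
  qed
  have "L u * L u' > 0"
    using connected_nonzero_same_sign[OF connU L _ assms] pos by fastforce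
  moreover have "(q u * q u') * (L u * L u') > 0"
    using mult_pos_pos[OF pos[OF assms(1)] pos[OF assms(2)]] by (simp add: mult_ac)
  ultimately show ?thesis using zero_less_mult_pos2 by blast
qed

text \<open>If \<open>c = 0\<close>, then \<open>m\<close> is constant, both principal curvatures equal \<open>- q\<close>, and $q^2 = K$. As the
  sign of \<open>q\<close> does not change, the principal curvatures are constant.\<close>

lemma first_integral_nonzero:
  assumes u: "u \<in> U"
  shows "c u \<noteq> 0"
proof
  assume c0: "c u = 0"
  have M: "K * (1 + (m x)\<^sup>2) = 1" if x: "x \<in> U" for x
  proof -
    have "c x = 0" using first_integral[OF u x] c0 by simp
    then have "inverse (1 + (m x)\<^sup>2) = K" using r_pos[OF x] by (simp add: c_def)
    moreover have "1 + (m x)\<^sup>2 \<noteq> 0" by (smt (verit) zero_le_power2)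
    ultimately show ?thesis by (metis left_inverse)
  qed
  have qK: "(q x)\<^sup>2 = K" if x: "x \<in> U" for x
  proof -
    have "(q x)\<^sup>2 * (1 + (m x)\<^sup>2) = K * (1 + (m x)\<^sup>2)" "1 + (m x)\<^sup>2 \<noteq> 0"
      using M[OF x] unit_normal_slope(2)[OF x] by auto
    then show ?thesis by simp
  qed
  have "curv1 f x = - q x" if x: "x \<in> U" for x
  proof -
    have II: "fund_form2 f x v w = - q x * fund_form1 f x v w" for v w
      unfolding second_form_slope[OF x] slope_derivative[OF x] M[OF x] by simp
    have "k = - q x" if "v \<noteq> 0" "\<forall>w. fund_form2 f x v w = k * fund_form1 f x v w" for k v
    proof -
      have "(k + q x) * fund_form1 f x v v = 0"
        using that(2)[rule_format, of v] unfolding II by (simp add: algebra_simps)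
      then show ?thesis using first_form_pos[OF x that(1)] by simp
    qed
    moreover have "(1::real, 0::real) \<noteq> 0" by (simp add: zero_prod_def)
    ultimately have "principal_curvatures f x = {- q x}"
      unfolding principal_curvatures_def using II by blast
    then show ?thesis by (simp add: curv1_def)
  qed
  moreover have "q x = q u" if x: "x \<in> U" for x
  proof -
    have "q x = q u \<or> q x = - q u"
      using qK[OF x] qK[OF u] power2_eq_iff[of "q x" "q u"] by simp
    moreover have "q x \<noteq> - q u"
    proof
      assume "q x = - q u"
      then have "0 < - (q u * q u)" using normal_sign_constant[OF x u] by simp
      then show False using zero_le_square[of "q u"] by linarith
    qed
    ultimately show ?thesis by blast
  qed
  ultimately have "\<forall>x\<in>U. curv1 f x = - q u" by simp
  then have "curv1 f constant_on U" unfolding constant_on_def by blast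
  then show False using not_tubular by (simp add: tubular_def)
qed

end

context parabolic_surface_constant_curvature
begin

text \<open>The constant \<open>a\<close> by which $\psi$ is shifted is absorbed by the parabolic rotation in the
  direction of \<open>b3\<close>.\<close>

lemma f_eq_parabolic_param:
  assumes u: "u \<in> U" and s: "R s = r u" "\<Psi> s = ps u - a"
  shows "f u = parabolic_param b0 (b1 + a *\<^sub>R b3 + (a\<^sup>2 / 2) *\<^sub>R b0) b2 (b3 + a *\<^sub>R b0) R \<Psi> (s, th u)"
proof -
  have r: "r u > 0" using r_pos[OF u] .
  have "mink (f u) (f u) = 2 * r u * mink (f u) b1 + (r u * th u)\<^sup>2 + (r u * ps u)\<^sup>2"
    by (subst pseudo_orthonormal_mink[OF basis]) (simp add: f_coords[OF u] power2_eq_square)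
  then have f1: "- mink (f u) b1 = ((r u)\<^sup>2 * ((th u)\<^sup>2 + (ps u)\<^sup>2) + 1) / (2 * r u)"
    using r f_coords(4)[OF u] by (simp add: field_simps power_mult_distrib)
  have "f u = (((r u)\<^sup>2 * ((th u)\<^sup>2 + (ps u)\<^sup>2) + 1) / (2 * r u)) *\<^sub>R b0 + r u *\<^sub>R b1 +
     (r u * th u) *\<^sub>R b2 + (r u * ps u) *\<^sub>R b3"
    by (subst pseudo_orthonormal_expansion[OF basis, of "f u"]) (simp only: f1 f_coords[OF u] minus_minus)
  also have "((r u)\<^sup>2 * ((th u)\<^sup>2 + (ps u)\<^sup>2) + 1) / (2 * r u) =
      ((r u)\<^sup>2 * ((th u)\<^sup>2 + (ps u - a)\<^sup>2) + 1) / (2 * r u) + r u * (a\<^sup>2 / 2) + r u * (ps u - a) * a"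
    using r by (simp add: field_simps power2_eq_square)
  finally show ?thesis
    unfolding parabolic_param_def by (simp add: s algebra_simps)
qed

lemma pseudo_orthonormal_shift:
  "pseudo_orthonormal b0 (b1 + a *\<^sub>R b3 + (a\<^sup>2 / 2) *\<^sub>R b0) b2 (b3 + a *\<^sub>R b0)"
  by (simp add: pseudo_orthonormal_def mink_bilinear_simps pseudo_orthonormal_simps[OF basis] power2_eq_square)

text \<open>The function \<open>S\<close> gives the parameter in terms of the slope. Its derivative is the one for which
  $ds = d\psi / w$, so $\Psi \circ s$ and $\psi$ differ by a constant. A point \<open>(s u, t)\<close> is attained because
  some \<open>u'\<close> has the same profile point as \<open>u\<close> and $\theta = t$, and $\Psi$ is injective on \<open>I\<close>.\<close>

lemma parametrised_by_slope:
  assumes S: "\<And>u. u \<in> U \<Longrightarrow> (S has_real_derivative - (r u * inverse (1 + (m u)\<^sup>2) / c u)) (at (m u))"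
    and R: "\<And>u. u \<in> U \<Longrightarrow> R (S (m u)) = r u"
    and \<Psi>: "\<And>u. u \<in> U \<Longrightarrow> (\<Psi> has_real_derivative inverse (1 + (m u)\<^sup>2)) (at (S (m u)))"
  shows "\<exists>b0 b1 b2 b3 I \<phi>. pseudo_orthonormal b0 b1 b2 b3 \<and> open I \<and> is_interval I \<and> (\<forall>s\<in>I. R s > 0) \<and>
    reparametrisation \<phi> U (I \<times> UNIV) \<and> (\<forall>u\<in>U. f u = parabolic_param b0 b1 b2 b3 R \<Psi> (\<phi> u))"
proof -
  define s where "s = (\<lambda>u. S (m u))"
  have M: "1 + (m u)\<^sup>2 > 0" for u by (simp add: add_pos_nonneg)
  have ds: "(s has_derivative (\<lambda>v. (1 + m u * m u) * D ps u v)) (at u)" if u: "u \<in> U" for u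
  proof -
    define M r' where "M = 1 + (m u)\<^sup>2" and "r' = r u"
    have pos: "M > 0" "r' > 0" using M r_pos[OF u] by (simp_all add: M_def r'_def)
    have c: "c u * M = (1 - K * M) * r'\<^sup>2"
      using pos(1) by (simp add: c_def M_def r'_def field_simps)
    have "- (r' * inverse M / c u) * (r' * M * (K * M - 1) * D ps u v) = M * D ps u v" for v
    proof -
      have "- (r' * inverse M / c u) * (r' * M * (K * M - 1) * D ps u v)
          = (inverse M * M) * ((1 - K * M) * r'\<^sup>2) * D ps u v / c u"
        by (simp add: power2_eq_square algebra_simps add_divide_distrib[symmetric] diff_divide_distrib[symmetric])
      also have "\<dots> = M * D ps u v"
        unfolding c[symmetric] using pos first_integral_nonzero[OF u] by simp
      finally show ?thesis .
    qed
    moreover have "((\<lambda>u. S (m u)) has_derivative (\<lambda>v. - (r u * inverse (1 + (m u)\<^sup>2) / c u) * D m u v)) (at u)"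
      using has_derivative_compose[OF smooth_on_derivative[OF smooth_m u]
        S[OF u, unfolded has_field_derivative_def]] by simp
    ultimately show ?thesis
      unfolding s_def slope_derivative[OF u] M_def[symmetric] r'_def
      by (simp add: M_def power2_eq_square)
  qed
  have smooth_s: "smooth_on s U"
  proof (rule smooth_on_derivI[OF openU ds])
    show "smooth_on (\<lambda>u. (1 + m u * m u) * D ps u v) U" for v
      by (intro smooth_on_mult smooth_on_add smooth_on_const smooth_on_frechet openU smooth_m smooth_ps)
  qed
  obtain u0 where u0: "u0 \<in> U" using neU by blast
  define a where "a = ps u0 - \<Psi> (s u0)"
  have \<Psi>s: "\<Psi> (s u) = ps u - a" if u: "u \<in> U" for u
  proof -
    have "ps u - \<Psi> (s u) = ps u0 - \<Psi> (s u0)"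
    proof (rule constant_if_derivative_zero[OF openU connU _ u u0])
      fix u assume u: "u \<in> U"
      have "((\<lambda>u. \<Psi> (s u)) has_derivative (\<lambda>v. inverse (1 + (m u)\<^sup>2) * ((1 + m u * m u) * D ps u v))) (at u)"
        using has_derivative_compose[OF ds[OF u]] \<Psi>[OF u] unfolding has_field_derivative_def s_def by blast
      moreover have "inverse (1 + (m u)\<^sup>2) * ((1 + m u * m u) * D ps u v) = D ps u v" for v
        using M[of u] by (simp add: power2_eq_square mult.assoc[symmetric])
      ultimately have "((\<lambda>u. \<Psi> (s u)) has_derivative (\<lambda>v. D ps u v)) (at u)"
        by (simp only:)
      from has_derivative_diff[OF smooth_on_derivative[OF smooth_ps u] this]
      show "((\<lambda>u. ps u - \<Psi> (s u)) has_derivative (\<lambda>v. 0)) (at u)" by simp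
    qed
    then show ?thesis by (simp add: a_def)
  qed
  define I where "I = s ` U"
  have "connected I" unfolding I_def
    using connected_continuous_image smooth_on_continuous[OF smooth_s] connU by blast
  then have interval: "is_interval I" by (simp add: is_interval_connected_1)
  have "s u \<in> interior I" if u: "u \<in> U" for u
  proof -
    obtain v where v: "D ps u v \<noteq> 0" using profile_graph[OF u] curvature[OF u] K by metis
    define d where "d = (1 + m u * m u) * D ps u v"
    have d: "d \<noteq> 0" using v M[of u] by (simp add: d_def power2_eq_square)
    have "bounded_linear (\<lambda>h. (h / d) *\<^sub>R v)"
      by (intro bounded_linear_scaleR_left[THEN bounded_linear_compose] bounded_linear_divide)
    moreover have "(\<lambda>v. (1 + m u * m u) * D ps u v) \<circ> (\<lambda>h. (h / d) *\<^sub>R v) = id"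
    proof
      fix h
      have "(1 + m u * m u) * D ps u ((h / d) *\<^sub>R v) = (h / d) * d"
        by (simp add: linear_scale[OF linD(3)[OF u]] d_def)
      then show "((\<lambda>v. (1 + m u * m u) * D ps u v) \<circ> (\<lambda>h. (h / d) *\<^sub>R v)) h = id h"
        using d by simp
    qed
    ultimately show ?thesis unfolding I_def
      using sussmann_open_mapping[OF openU smooth_on_continuous[OF smooth_s] u ds[OF u] _ _ order_refl]
        openU u by (simp add: interior_open)
  qed
  then have "I \<subseteq> interior I" by (auto simp: I_def)
  then have openI: "open I" by (metis interior_subset open_interior subset_antisym)
  have \<Psi>_less: "\<Psi> x < \<Psi> y" if "x \<in> I" "y \<in> I" "x < y" for x y
  proof (rule DERIV_pos_imp_increasing[OF \<open>x < y\<close>])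
    fix z assume "x \<le> z" "z \<le> y"
    then have "z \<in> I" using interval that by (meson mem_is_interval_1_I)
    then obtain u where "u \<in> U" "z = S (m u)" by (auto simp: I_def s_def)
    then show "\<exists>y. (\<Psi> has_real_derivative y) (at z) \<and> 0 < y"
      using \<Psi> M[of u] by (metis inverse_positive_iff_positive)
  qed
  define \<phi> where "\<phi> = (\<lambda>u. (s u, th u))"
  have "\<phi> ` U = I \<times> UNIV"
  proof
    show "\<phi> ` U \<subseteq> I \<times> UNIV" by (auto simp: \<phi>_def I_def)
    show "I \<times> UNIV \<subseteq> \<phi> ` U"
    proof clarify
      fix x t assume "x \<in> I"
      then obtain u where u: "u \<in> U" "x = s u" by (auto simp: I_def)
      obtain u' where u': "u' \<in> U" "r u' = r u" "ps u' = ps u" "th u' = t"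
        by (rule invariant_coords[OF u(1)])
      have "\<Psi> (s u') = \<Psi> (s u)" using u u' \<Psi>s by simp
      moreover have "s u \<in> I" "s u' \<in> I" using u u' by (auto simp: I_def)
      ultimately have "s u' = s u" using \<Psi>_less by (metis less_irrefl linorder_neqE_linordered_idom)
      then have "(x, t) = \<phi> u'" using u u' by (simp add: \<phi>_def)
      then show "(x, t) \<in> \<phi> ` U" using u' by blast
    qed
  qed
  moreover have "smooth_on \<phi> U"
    unfolding \<phi>_def by (rule smooth_on_Pair[OF openU smooth_s smooth_th])
  moreover have "bij (frechet_derivative \<phi> (at u))" if u: "u \<in> U" for u
  proof -
    let ?L = "\<lambda>v. ((1 + m u * m u) * D ps u v, D th u v)"
    have d\<phi>: "(\<phi> has_derivative ?L) (at u)"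
      unfolding \<phi>_def by (intro has_derivative_Pair ds smooth_on_derivative[OF smooth_th] u)
    then have lin: "linear ?L" using has_derivative_linear by blast
    have ker: "v = 0" if "?L v = 0" for v
    proof -
      have "D ps u v = 0" "D th u v = 0"
        using that M[of u] by (auto simp: zero_prod_def power2_eq_square)
      then show ?thesis using immersed[OF u, of v] slope[OF u, of v] by simp
    qed
    have "inj ?L" unfolding linear_injective_0[OF lin] using ker by blast
    then have "bij ?L" using linear_injective_imp_surjective[OF lin] unfolding bij_def by blast
    then show ?thesis unfolding frechet_derivative_at[OF d\<phi>] .
  qed
  ultimately have "reparametrisation \<phi> U (I \<times> UNIV)" by (simp add: reparametrisation_def)
  moreover have "f u = parabolic_param b0 (b1 + a *\<^sub>R b3 + (a\<^sup>2 / 2) *\<^sub>R b0) b2 (b3 + a *\<^sub>R b0) R \<Psi> (\<phi> u)"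
    if u: "u \<in> U" for u
    unfolding \<phi>_def by (rule f_eq_parabolic_param[where s = "s u" and a = a and R = R and \<Psi> = \<Psi>, OF u _ \<Psi>s[OF u]]) (simp add: s_def R[OF u])
  moreover have "\<forall>s\<in>I. R s > 0" using R r_pos by (auto simp: I_def s_def)
  ultimately show ?thesis using pseudo_orthonormal_shift[of a] openI interval
    by (intro exI[of _ b0] exI[of _ "b1 + a *\<^sub>R b3 + (a\<^sup>2 / 2) *\<^sub>R b0"] exI[of _ b2]
        exI[of _ "b3 + a *\<^sub>R b0"] exI[of _ I] exI[of _ \<phi>]) simp
qed

end

section \<open>Elliptic integrals and the Jacobi amplitude\<close>

lemma LBINT_has_real_derivative:
  fixes g :: "real \<Rightarrow> real"
  assumes "continuous_on UNIV g"
  shows "((\<lambda>x. LBINT u=ereal 0..ereal x. g u) has_real_derivative g x) (at x)"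
proof -
  define a b where "a = min 0 x - 1" and "b = max 0 x + 1"
  have "a \<le> 0" "0 \<le> b" "a \<le> x" "x \<le> b" by (simp_all add: a_def b_def)
  moreover have "continuous_on {a..b} g" using assms by (rule continuous_on_subset) simp
  ultimately have "((\<lambda>x. LBINT u=ereal 0..ereal x. g u) has_vector_derivative g x) (at x within {a..b})"
    using interval_integral_FTC2[of a 0 b g x] by blast
  moreover have "at x within {a..b} = at x"
    by (rule at_within_interior) (auto simp: a_def b_def)
  ultimately show ?thesis
    unfolding has_real_derivative_iff_has_vector_derivative by (simp only:)
qed

lemma modulus_pos:
  fixes p y :: real
  assumes "p\<^sup>2 < 1"
  shows "1 - p\<^sup>2 * (sin y)\<^sup>2 > 0"
proof -
  have "(sin y)\<^sup>2 \<le> 1" by (simp add: abs_square_le_1)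
  then have "p\<^sup>2 * (sin y)\<^sup>2 \<le> p\<^sup>2 * 1" by (intro mult_left_mono) auto
  then show ?thesis using assms by simp
qed

lemma ellF_derivative:
  assumes p: "p\<^sup>2 < 1"
  shows "(ellF p has_real_derivative 1 / sqrt (1 - p\<^sup>2 * (sin x)\<^sup>2)) (at x)"
proof -
  have "sqrt (1 - p\<^sup>2 * (sin u)\<^sup>2) \<noteq> 0" for u using modulus_pos[OF p, of u] by simp
  then have "continuous_on UNIV (\<lambda>u. 1 / sqrt (1 - p\<^sup>2 * (sin u)\<^sup>2))"
    by (intro continuous_intros) auto
  from LBINT_has_real_derivative[OF this] show ?thesis unfolding ellF_def[abs_def] .
qed

lemma ellE_derivative: "(ellE p has_real_derivative sqrt (1 - p\<^sup>2 * (sin x)\<^sup>2)) (at x)"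
proof -
  have "continuous_on UNIV (\<lambda>u. sqrt (1 - p\<^sup>2 * (sin u)\<^sup>2))" by (intro continuous_intros)
  from LBINT_has_real_derivative[OF this] show ?thesis unfolding ellE_def[abs_def] .
qed

lemma ellF_less:
  assumes p: "p\<^sup>2 < 1" and "x < y"
  shows "ellF p x < ellF p y"
  using DERIV_pos_imp_increasing[OF \<open>x < y\<close>] ellF_derivative[OF p] modulus_pos[OF p]
  by (metis real_sqrt_gt_zero zero_less_divide_1_iff)

lemma ellF_inject: "p\<^sup>2 < 1 \<Longrightarrow> ellF p x = ellF p y \<longleftrightarrow> x = y"
  using ellF_less by (metis less_irrefl linorder_neqE_linordered_idom)

text \<open>The integrand of \<open>ellF\<close> is at least one, so \<open>ellF\<close> grows at least as fast as the identity.\<close>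

lemma ellF_surj:
  assumes p: "p\<^sup>2 < 1"
  shows "\<exists>x. ellF p x = s"
proof -
  define G where "G = (\<lambda>x. ellF p x - x)"
  have dG: "(G has_real_derivative (1 / sqrt (1 - p\<^sup>2 * (sin x)\<^sup>2) - 1)) (at x)" for x
    unfolding G_def by (intro DERIV_diff ellF_derivative[OF p] DERIV_ident)
  have ge: "1 / sqrt (1 - p\<^sup>2 * (sin x)\<^sup>2) - 1 \<ge> 0" for x
  proof -
    have "sqrt (1 - p\<^sup>2 * (sin x)\<^sup>2) \<le> 1" by simp
    then show ?thesis using modulus_pos[OF p, of x] by simp
  qed
  have mono: "G x \<le> G y" if "x \<le> y" for x y
    using DERIV_nonneg_imp_nondecreasing[OF that] dG ge by blast
  define a where "a = \<bar>s\<bar> + \<bar>ellF p 0\<bar>"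
  have "ellF p (- a) \<le> s" "s \<le> ellF p a"
    using mono[of "- a" 0] mono[of 0 a] unfolding G_def a_def by linarith+
  moreover have "isCont (ellF p) x" for x using ellF_derivative[OF p] DERIV_isCont by blast
  moreover have "- a \<le> a" by (simp add: a_def)
  ultimately show ?thesis using IVT[of "ellF p" "- a" s a] by blast
qed

lemma jacobi_am_ellF: "p\<^sup>2 < 1 \<Longrightarrow> jacobi_am p (ellF p x) = x"
  unfolding jacobi_am_def using ellF_inject by (auto intro: the_equality)

lemma ellF_jacobi_am: "p\<^sup>2 < 1 \<Longrightarrow> ellF p (jacobi_am p s) = s"
  using ellF_surj jacobi_am_ellF by metis

lemma jacobi_am_derivative:
  assumes p: "p\<^sup>2 < 1"
  shows "(jacobi_am p has_real_derivative jacobi_dn p s) (at s)"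
proof -
  define x where "x = jacobi_am p s"
  have s: "ellF p x = s" using ellF_jacobi_am[OF p] by (simp add: x_def)
  have "isCont (jacobi_am p) (ellF p x)"
  proof (rule isCont_inverse_function2[of "x - 1" x "x + 1"])
    show "isCont (ellF p) z" for z by (rule DERIV_isCont[OF ellF_derivative[OF p]])
  qed (simp_all add: jacobi_am_ellF[OF p])
  then have "isCont (jacobi_am p) s" by (simp add: s)
  then have "(jacobi_am p has_real_derivative inverse (1 / sqrt (1 - p\<^sup>2 * (sin x)\<^sup>2))) (at s)"
  proof (rule DERIV_inverse_function[where f = "ellF p" and a = "s - 1" and b = "s + 1", rotated 5])
    show "(ellF p has_real_derivative 1 / sqrt (1 - p\<^sup>2 * (sin x)\<^sup>2)) (at (jacobi_am p s))"
      using ellF_derivative[OF p, of x] by (simp only: x_def)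
    show "1 / sqrt (1 - p\<^sup>2 * (sin x)\<^sup>2) \<noteq> 0" using modulus_pos[OF p, of x] by simp
  qed (simp_all add: ellF_jacobi_am[OF p])
  then show ?thesis by (simp add: jacobi_dn_def jacobi_sn_def x_def)
qed

lemma jacobi_dn_squared: "p\<^sup>2 < 1 \<Longrightarrow> (jacobi_dn p s)\<^sup>2 = 1 - p\<^sup>2 * (jacobi_sn p s)\<^sup>2"
  using modulus_pos[of p "jacobi_am p s"] by (simp add: jacobi_dn_def jacobi_sn_def)

lemma ellE_am_derivative:
  assumes p: "p\<^sup>2 < 1"
  shows "((\<lambda>s. ellE p (jacobi_am p s)) has_real_derivative (jacobi_dn p s)\<^sup>2) (at s)"
proof -
  have "(ellE p has_real_derivative jacobi_dn p s) (at (jacobi_am p s))"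
    using ellE_derivative[of p "jacobi_am p s"] by (simp only: jacobi_dn_def jacobi_sn_def)
  from DERIV_chain2[OF this jacobi_am_derivative[OF p]] show ?thesis
    by (simp only: power2_eq_square)
qed

lemma ellPi_derivative:
  assumes p: "p\<^sup>2 < 1"
  shows "((\<lambda>s. ellPi (p\<^sup>2) s p) has_real_derivative 1 / (jacobi_dn p s)\<^sup>2) (at s)"
proof -
  have "continuous_on UNIV (jacobi_am p)"
    using jacobi_am_derivative[OF p] DERIV_isCont continuous_at_imp_continuous_on by blast
  then have "continuous_on UNIV (\<lambda>u. 1 / (1 - p\<^sup>2 * (jacobi_sn p u)\<^sup>2))"
    unfolding jacobi_sn_def
  proof (intro continuous_intros ballI)
    show "1 - p\<^sup>2 * (sin (jacobi_am p u))\<^sup>2 \<noteq> 0" for u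
      using modulus_pos[OF p, of "jacobi_am p u"] by simp
  qed
  from LBINT_has_real_derivative[OF this] show ?thesis
    unfolding ellPi_def[abs_def] jacobi_dn_squared[OF p] .
qed

lemma ellPi_profile_derivative:
  assumes p: "p\<^sup>2 < 1" and "\<Xi> \<noteq> 0"
  shows "((\<lambda>s. A * s - B / \<Xi> * ellPi (p\<^sup>2) (\<Xi> * s) p) has_real_derivative
    A - B / (jacobi_dn p (\<Xi> * s))\<^sup>2) (at s)"
proof -
  have "((\<lambda>s. ellPi (p\<^sup>2) (\<Xi> * s) p) has_real_derivative 1 / (jacobi_dn p (\<Xi> * s))\<^sup>2 * \<Xi>) (at s)"
    by (rule DERIV_chain2[OF ellPi_derivative[OF p]]) (auto intro!: derivative_eq_intros)
  then show ?thesis using assms(2) by (auto intro!: derivative_eq_intros)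
qed

lemma ellE_profile_derivative:
  assumes p: "p\<^sup>2 < 1" and "\<Xi> \<noteq> 0"
  shows "((\<lambda>s. 1 / \<Xi> * ellE p (jacobi_am p (\<Xi> * s))) has_real_derivative
    (jacobi_dn p (\<Xi> * s))\<^sup>2) (at s)"
proof -
  have "((\<lambda>s. ellE p (jacobi_am p (\<Xi> * s))) has_real_derivative (jacobi_dn p (\<Xi> * s))\<^sup>2 * \<Xi>) (at s)"
    by (rule DERIV_chain2[OF ellE_am_derivative[OF p]]) (auto intro!: derivative_eq_intros)
  then show ?thesis using assms(2) by (auto intro!: derivative_eq_intros)
qed

text \<open>The parameter is described by its amplitude $\alpha$. Then the values of the Jacobi functions
  are trigonometric functions of $\alpha$, and only \<open>\<delta>\<close>, the value of \<open>jacobi_dn\<close>, enters the derivative.\<close>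

lemma ellF_substitution:
  assumes p: "p\<^sup>2 < 1" and \<Xi>: "\<Xi> > 0" and \<alpha>: "(\<alpha> has_real_derivative \<alpha>') (at x)"
    and \<delta>: "\<delta> > 0" "1 - p\<^sup>2 * (sin (\<alpha> x))\<^sup>2 = \<delta>\<^sup>2"
  shows "((\<lambda>x. ellF p (\<alpha> x) / \<Xi>) has_real_derivative \<alpha>' / (\<Xi> * \<delta>)) (at x)"
    and "jacobi_dn p (\<Xi> * (ellF p (\<alpha> x) / \<Xi>)) = \<delta>"
    and "jacobi_cn p (\<Xi> * (ellF p (\<alpha> x) / \<Xi>)) = cos (\<alpha> x)"
proof -
  have "((\<lambda>x. ellF p (\<alpha> x)) has_real_derivative 1 / sqrt (1 - p\<^sup>2 * (sin (\<alpha> x))\<^sup>2) * \<alpha>') (at x)"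
    by (rule DERIV_chain2[OF ellF_derivative[OF p] \<alpha>])
  moreover have "sqrt (1 - p\<^sup>2 * (sin (\<alpha> x))\<^sup>2) = \<delta>" using \<delta> by simp
  ultimately show "((\<lambda>x. ellF p (\<alpha> x) / \<Xi>) has_real_derivative \<alpha>' / (\<Xi> * \<delta>)) (at x)"
    using \<Xi> \<delta>(1) by (auto intro!: derivative_eq_intros simp: field_simps)
  have "jacobi_am p (\<Xi> * (ellF p (\<alpha> x) / \<Xi>)) = \<alpha> x" using \<Xi> jacobi_am_ellF[OF p] by simp
  then show "jacobi_dn p (\<Xi> * (ellF p (\<alpha> x) / \<Xi>)) = \<delta>"
    "jacobi_cn p (\<Xi> * (ellF p (\<alpha> x) / \<Xi>)) = cos (\<alpha> x)"
    using \<delta> by (simp_all add: jacobi_dn_def jacobi_sn_def jacobi_cn_def)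
qed

section \<open>The profile curves\<close>

lemma sin_arctan_squared: "(sin (arctan y))\<^sup>2 = y\<^sup>2 / (1 + y\<^sup>2)"
  by (simp add: sin_arctan power_divide add_pos_nonneg less_imp_le)

lemma cos_arctan_squared: "(cos (arctan y))\<^sup>2 = 1 / (1 + y\<^sup>2)"
  by (simp add: cos_arctan power_divide add_pos_nonneg less_imp_le)

text \<open>In this lemma and the following ones, \<open>x\<close> is the slope of the profile, \<open>\<rho>\<close> the value of \<open>r\<close>, and the equation
  for \<open>\<rho>\<close> is the first integral. The amplitude is found by solving the formula for \<open>r\<close> in the respective family
  for \<open>jacobi_dn\<close> or \<open>jacobi_cn\<close>, and substituting the first integral.

  The first integral gives $\rho^2 = |C| (1+x^2) / (1 - K - K x^2)$. The condition
  $\rho = \sqrt{C/K}\,\mathrm{dn}$ then amounts to $\tan\alpha = 1/(\kappa x)$ with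
  $\kappa^2 = K/(K-1)$. The branch with values in $(0, \pi)$ is smooth across $x = 0$.\<close>

lemma profile_negative:
  fixes K C x \<rho> :: real
  assumes K: "K < 0" and C: "C < 0" and \<rho>: "\<rho> > 0"
    and I: "(inverse (1 + x\<^sup>2) - K) * \<rho>\<^sup>2 = - C"
    and p: "p = sqrt (1 / (1 - K))" and \<Xi>: "\<Xi> = sqrt ((K - 1) * C)"
    and S: "S = (\<lambda>x. ellF p (pi / 2 - arctan (sqrt (K / (K - 1)) * x)) / \<Xi>)"
  shows "(S has_real_derivative \<rho> * inverse (1 + x\<^sup>2) / C) (at x)"
    and "sqrt (C / K) * jacobi_dn p (\<Xi> * S x) = \<rho>"
    and "((\<lambda>s. K * s - K / \<Xi> * ellPi (p\<^sup>2) (\<Xi> * s) p) has_real_derivative inverse (1 + x\<^sup>2)) (at (S x))"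
proof -
  define n l d where "n = sqrt (- K)" and "l = sqrt (1 - K)" and "d = sqrt (- C)"
  have pos: "n > 0" "l > 0" "d > 0" using K C by (simp_all add: n_def l_def d_def)
  have sq: "K = - (n\<^sup>2)" "l\<^sup>2 = 1 + n\<^sup>2" "C = - (d\<^sup>2)" using K C by (simp_all add: n_def l_def d_def)
  have p': "p = 1 / l" by (simp add: p l_def real_sqrt_divide)
  have "(K - 1) * C = (1 - K) * - C" by (simp add: algebra_simps)
  then have \<Xi>': "\<Xi> = l * d" by (simp only: \<Xi> l_def d_def real_sqrt_mult)
  have "K / (K - 1) = - K / (1 - K)" "C / K = - C / - K" using K by (simp_all add: field_simps)
  then have \<kappa>: "sqrt (K / (K - 1)) = n / l" and dn: "sqrt (C / K) = d / n"
    by (simp_all only: n_def l_def d_def real_sqrt_divide)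
  define X Q where "X = 1 + x\<^sup>2" and "Q = 1 + n\<^sup>2 * X"
  have X: "X > 0" "Q > 0" by (simp_all add: X_def Q_def add_pos_nonneg)
  have key: "\<rho>\<^sup>2 * Q = d\<^sup>2 * X"
    using I X unfolding sq(1,3) X_def[symmetric] by (simp add: Q_def field_simps)
  have "Q = l\<^sup>2 + n\<^sup>2 * x\<^sup>2" by (simp add: Q_def X_def sq(2) algebra_simps)
  then have arg: "1 + (n / l * x)\<^sup>2 = Q / l\<^sup>2"
    using pos by (simp add: power_divide power_mult_distrib add_divide_distrib)
  define \<alpha> where "\<alpha> = (\<lambda>x. pi / 2 - arctan (n / l * x))"
  define \<delta> where "\<delta> = \<rho> * n / d"
  have \<delta>: "\<delta> > 0" using pos \<rho> by (simp add: \<delta>_def)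
  have \<delta>2: "\<delta>\<^sup>2 = n\<^sup>2 * X / Q"
    using key pos X by (simp add: \<delta>_def power_divide power_mult_distrib field_simps)
  have p1: "p\<^sup>2 < 1" using K by (simp add: p)
  have \<alpha>': "(\<alpha> has_real_derivative - (n * l / Q)) (at x)"
  proof -
    have "(\<alpha> has_real_derivative - (inverse (1 + (n / l * x)\<^sup>2) * (n / l))) (at x)"
      unfolding \<alpha>_def using pos by (auto intro!: derivative_eq_intros)
    then show ?thesis unfolding arg using pos X by (simp add: power2_eq_square field_simps)
  qed
  have "1 - p\<^sup>2 * (sin (\<alpha> x))\<^sup>2 = \<delta>\<^sup>2"
  proof -
    have "(sin (\<alpha> x))\<^sup>2 = l\<^sup>2 / Q"
    proof -
      have "sin (\<alpha> x) = cos (arctan (n / l * x))" by (simp add: \<alpha>_def sin_diff)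
      then show ?thesis by (simp only: cos_arctan_squared arg) simp
    qed
    then show ?thesis unfolding \<delta>2 p' using pos X by (simp add: power_divide field_simps)
      (simp add: Q_def algebra_simps)
  qed
  note sub = ellF_substitution[OF p1 _ \<alpha>' \<delta> this, of \<Xi>]
  have Spos: "\<Xi> > 0" using pos by (simp add: \<Xi>')
  have S': "S = (\<lambda>x. ellF p (\<alpha> x) / \<Xi>)" by (simp add: S \<alpha>_def \<kappa>)
  have "- (n * l / Q) / (\<Xi> * \<delta>) = \<rho> * inverse X / C"
    using key pos X \<rho> unfolding sq(3) \<Xi>' \<delta>_def by (simp add: field_simps power2_eq_square)
  then show "(S has_real_derivative \<rho> * inverse (1 + x\<^sup>2) / C) (at x)"
    using sub(1)[OF Spos] unfolding S' X_def by simp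
  show "sqrt (C / K) * jacobi_dn p (\<Xi> * S x) = \<rho>"
    unfolding S' sub(2)[OF Spos] dn using pos by (simp add: \<delta>_def)
  have "K - K / \<delta>\<^sup>2 = inverse X"
    unfolding \<delta>2 sq(1) using pos X by (simp add: field_simps) (simp add: Q_def)
  then show "((\<lambda>s. K * s - K / \<Xi> * ellPi (p\<^sup>2) (\<Xi> * s) p) has_real_derivative inverse (1 + x\<^sup>2)) (at (S x))"
    using ellPi_profile_derivative[OF p1, of \<Xi> K K "S x"] Spos unfolding X_def
    by (simp add: S' sub(2)[OF Spos] del: times_divide_eq_right)
qed

text \<open>Here $\rho^2 = C (1+x^2) / (K - 1 + K x^2)$, and $\rho = \sqrt{C/(K-1)}\,\mathrm{dn}$ amounts to
  $\tan\alpha = \kappa x$ with $\kappa^2 = K/(K-1)$.\<close>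

lemma profile_gt_1:
  fixes K C x \<rho> :: real
  assumes K: "K > 1" and C: "C > 0" and \<rho>: "\<rho> > 0"
    and I: "(inverse (1 + x\<^sup>2) - K) * \<rho>\<^sup>2 = - C"
    and p: "p = sqrt (1 / K)" and \<Xi>: "\<Xi> = sqrt (K * C)"
    and S: "S = (\<lambda>x. ellF p (arctan (sqrt (K / (K - 1)) * x)) / \<Xi>)"
  shows "(S has_real_derivative \<rho> * inverse (1 + x\<^sup>2) / C) (at x)"
    and "sqrt (C / (K - 1)) * jacobi_dn p (\<Xi> * S x) = \<rho>"
    and "((\<lambda>s. K * s - (K - 1) / \<Xi> * ellPi (p\<^sup>2) (\<Xi> * s) p) has_real_derivative inverse (1 + x\<^sup>2)) (at (S x))"
proof -
  define k l d where "k = sqrt K" and "l = sqrt (K - 1)" and "d = sqrt C"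
  have pos: "k > 0" "l > 0" "d > 0" using K C by (simp_all add: k_def l_def d_def)
  have sq: "K = k\<^sup>2" "l\<^sup>2 = k\<^sup>2 - 1" "C = d\<^sup>2" using K C by (simp_all add: k_def l_def d_def)
  have p': "p = 1 / k" by (simp add: p k_def real_sqrt_divide)
  have \<Xi>': "\<Xi> = k * d" by (simp only: \<Xi> k_def d_def real_sqrt_mult)
  have \<kappa>: "sqrt (K / (K - 1)) = k / l" and dn: "sqrt (C / (K - 1)) = d / l"
    by (simp_all only: k_def l_def d_def real_sqrt_divide)
  define X Q where "X = 1 + x\<^sup>2" and "Q = l\<^sup>2 + k\<^sup>2 * x\<^sup>2"
  have X: "X > 0" "Q > 0" using pos by (simp_all add: X_def Q_def add_pos_nonneg)
  have QX: "Q = k\<^sup>2 * X - 1" unfolding Q_def X_def sq(2) by (simp add: algebra_simps)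
  have key: "\<rho>\<^sup>2 * Q = d\<^sup>2 * X"
    using I X unfolding sq(1,3) X_def[symmetric] by (simp add: QX field_simps)
  have arg: "1 + (k / l * x)\<^sup>2 = Q / l\<^sup>2"
    using pos by (simp add: Q_def power_divide power_mult_distrib add_divide_distrib)
  define \<alpha> where "\<alpha> = (\<lambda>x. arctan (k / l * x))"
  define \<delta> where "\<delta> = \<rho> * l / d"
  have \<delta>: "\<delta> > 0" using pos \<rho> by (simp add: \<delta>_def)
  have \<delta>2: "\<delta>\<^sup>2 = l\<^sup>2 * X / Q"
    using key pos X by (simp add: \<delta>_def power_divide power_mult_distrib field_simps)
  have p1: "p\<^sup>2 < 1" using K by (simp add: p)
  have \<alpha>': "(\<alpha> has_real_derivative k * l / Q) (at x)"
  proof -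
    have "(\<alpha> has_real_derivative inverse (1 + (k / l * x)\<^sup>2) * (k / l)) (at x)"
      unfolding \<alpha>_def using pos by (auto intro!: derivative_eq_intros)
    then show ?thesis unfolding arg using pos X by (simp add: power2_eq_square field_simps)
  qed
  have "1 - p\<^sup>2 * (sin (\<alpha> x))\<^sup>2 = \<delta>\<^sup>2"
  proof -
    have "(sin (\<alpha> x))\<^sup>2 = k\<^sup>2 * x\<^sup>2 / Q"
      unfolding \<alpha>_def sin_arctan_squared arg using pos by (simp add: power_divide power_mult_distrib)
    then have "1 - p\<^sup>2 * (sin (\<alpha> x))\<^sup>2 = (Q - x\<^sup>2) / Q"
      unfolding p' using pos X by (simp add: power_divide field_simps)
    also have "Q - x\<^sup>2 = l\<^sup>2 * X" unfolding Q_def X_def sq(2) by (simp add: algebra_simps)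
    finally show ?thesis unfolding \<delta>2 .
  qed
  note sub = ellF_substitution[OF p1 _ \<alpha>' \<delta> this, of \<Xi>]
  have Spos: "\<Xi> > 0" using pos by (simp add: \<Xi>')
  have S': "S = (\<lambda>x. ellF p (\<alpha> x) / \<Xi>)" by (simp add: S \<alpha>_def \<kappa>)
  have "(k * l / Q) / (\<Xi> * \<delta>) = \<rho> * inverse X / C"
    using key pos X \<rho> unfolding sq(3) \<Xi>' \<delta>_def by (simp add: field_simps power2_eq_square)
  then show "(S has_real_derivative \<rho> * inverse (1 + x\<^sup>2) / C) (at x)"
    using sub(1)[OF Spos] unfolding S' X_def by simp
  show "sqrt (C / (K - 1)) * jacobi_dn p (\<Xi> * S x) = \<rho>"
    unfolding S' sub(2)[OF Spos] dn using pos by (simp add: \<delta>_def)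
  have "K - (K - 1) / \<delta>\<^sup>2 = k\<^sup>2 - Q / X"
    unfolding \<delta>2 sq(1) sq(2)[symmetric] using pos X by simp
  also have "\<dots> = inverse X" unfolding QX using X by (simp add: field_simps)
  finally show "((\<lambda>s. K * s - (K - 1) / \<Xi> * ellPi (p\<^sup>2) (\<Xi> * s) p) has_real_derivative inverse (1 + x\<^sup>2)) (at (S x))"
    using ellPi_profile_derivative[OF p1, of \<Xi> K "K - 1" "S x"] Spos unfolding X_def
    by (simp add: S' sub(2)[OF Spos] del: times_divide_eq_right)
qed

lemma arcsin_has_real_derivative:
  assumes "(y has_real_derivative y') (at x)" "z > 0" "1 - (y x)\<^sup>2 = z\<^sup>2"
  shows "((\<lambda>x. arcsin (y x)) has_real_derivative y' / z) (at x)"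
    and "sin (arcsin (y x)) = y x" and "cos (arcsin (y x)) = z"
proof -
  have "(y x)\<^sup>2 < 1" using assms(2,3) by (smt (verit) zero_less_power)
  then have y: "- 1 < y x" "y x < 1" by (simp_all add: abs_square_less_1 abs_less_iff)
  have z: "sqrt (1 - (y x)\<^sup>2) = z" using assms(2,3) by simp
  show "((\<lambda>x. arcsin (y x)) has_real_derivative y' / z) (at x)"
    using DERIV_chain2[OF DERIV_arcsin[OF y] assms(1)] unfolding z by (simp add: field_simps)
  show "sin (arcsin (y x)) = y x" "cos (arcsin (y x)) = z" using y z by (simp_all add: cos_arcsin)
qed

lemma sqrt_one_plus_square_derivative:
  "((\<lambda>x. sqrt (1 + x\<^sup>2)) has_real_derivative x / sqrt (1 + x\<^sup>2)) (at x)"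
proof -
  have "1 + x\<^sup>2 > 0" by (simp add: add_pos_nonneg)
  then have "(sqrt has_real_derivative inverse (sqrt (1 + x\<^sup>2)) / 2) (at (1 + x\<^sup>2))"
    by (rule DERIV_real_sqrt)
  moreover have "((\<lambda>x. 1 + x\<^sup>2) has_real_derivative 2 * x) (at x)"
    by (auto intro!: derivative_eq_intros)
  ultimately have "((\<lambda>x. sqrt (1 + x\<^sup>2)) has_real_derivative inverse (sqrt (1 + x\<^sup>2)) / 2 * (2 * x)) (at x)"
    by (rule DERIV_chain2)
  then show ?thesis by (simp add: field_simps)
qed

text \<open>With $p^2 = 1 - K$ the first integral gives $\mathrm{cn}^2 = |C| / (p^2 \rho^2) = 1 - x^2 / (p^2 (1+x^2))$,
  and $\mathrm{dn}^2 = w$ is the derivative of $\psi$. The slope decreases along the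
  profile, which determines the sign of the amplitude.\<close>

lemma profile_between_positive:
  fixes K C x \<rho> :: real
  assumes K: "0 < K" "K < 1" and C: "C < 0" and \<rho>: "\<rho> > 0"
    and I: "(inverse (1 + x\<^sup>2) - K) * \<rho>\<^sup>2 = - C"
    and p: "p = sqrt (1 - K)" and \<Xi>: "\<Xi> = sqrt (- C)"
    and S: "S = (\<lambda>x. ellF p (arcsin (- x / (p * sqrt (1 + x\<^sup>2)))) / \<Xi>)"
  shows "(S has_real_derivative \<rho> * inverse (1 + x\<^sup>2) / C) (at x)"
    and "sqrt (C / (K - 1)) * jacobi_nc p (\<Xi> * S x) = \<rho>"
    and "((\<lambda>s. 1 / \<Xi> * ellE p (jacobi_am p (\<Xi> * s))) has_real_derivative inverse (1 + x\<^sup>2)) (at (S x))"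
proof -
  have pos: "p > 0" "\<Xi> > 0" using K C by (simp_all add: p \<Xi>)
  have sq: "K = 1 - p\<^sup>2" "C = - (\<Xi>\<^sup>2)" using K C by (simp_all add: p \<Xi>)
  have p1: "p\<^sup>2 < 1" using K by (simp add: p)
  have "C / (K - 1) = - C / (1 - K)" using K by (simp add: field_simps)
  then have nc: "sqrt (C / (K - 1)) = \<Xi> / p"
    by (simp only: p \<Xi> real_sqrt_divide)
  define e where "e = sqrt (1 + x\<^sup>2)"
  have e: "e > 0" "e\<^sup>2 = 1 + x\<^sup>2" by (simp_all add: e_def add_pos_nonneg)
  have key: "\<rho>\<^sup>2 * (p\<^sup>2 * e\<^sup>2 - x\<^sup>2) = \<Xi>\<^sup>2 * e\<^sup>2"
  proof -
    have "(1 - K * e\<^sup>2) * \<rho>\<^sup>2 = \<Xi>\<^sup>2 * e\<^sup>2"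
      using I e unfolding sq(2) e(2)[symmetric] by (simp add: field_simps)
    moreover have "1 - K * e\<^sup>2 = p\<^sup>2 * e\<^sup>2 - x\<^sup>2" unfolding sq(1) using e(2) by (simp add: algebra_simps)
    ultimately show ?thesis by (simp add: mult.commute)
  qed
  define y where "y = (\<lambda>x. - x / (p * sqrt (1 + x\<^sup>2)))"
  have yx: "y x = - x / (p * e)" by (simp add: y_def e_def)
  have y': "(y has_real_derivative - 1 / (p * e ^ 3)) (at x)"
  proof -
    have "(y has_real_derivative (- 1 * (p * e) - - x * (p * (x / e))) / ((p * e) * (p * e))) (at x)"
      unfolding y_def e_def
      by (intro DERIV_divide DERIV_minus DERIV_ident DERIV_cmult sqrt_one_plus_square_derivative)
         (use pos e in \<open>simp add: e_def\<close>)
    moreover have "(- 1 * (p * e) - - x * (p * (x / e))) / ((p * e) * (p * e)) = - (e\<^sup>2 - x\<^sup>2) / (p * e ^ 3)"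
      using pos e(1) by (simp add: field_simps power2_eq_square power3_eq_cube)
    ultimately show ?thesis using e(2) by simp
  qed
  define z where "z = \<Xi> / (p * \<rho>)"
  have z: "z > 0" using pos \<rho> by (simp add: z_def)
  have "1 - (y x)\<^sup>2 = (p\<^sup>2 * e\<^sup>2 - x\<^sup>2) / (p\<^sup>2 * e\<^sup>2)"
    unfolding yx using pos e(1) by (simp add: power_divide power_mult_distrib field_simps)
  also have "\<dots> = (\<rho>\<^sup>2 * (p\<^sup>2 * e\<^sup>2 - x\<^sup>2)) / (\<rho>\<^sup>2 * (p\<^sup>2 * e\<^sup>2))" using \<rho> by simp
  also have "\<dots> = z\<^sup>2"
    unfolding key z_def using pos e(1) \<rho> by (simp add: power_divide power_mult_distrib mult.commute)
  finally have yz: "1 - (y x)\<^sup>2 = z\<^sup>2" .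
  note arc = arcsin_has_real_derivative[OF y' z yz]
  define \<delta> where "\<delta> = 1 / e"
  have \<delta>: "\<delta> > 0" "\<delta>\<^sup>2 = inverse (1 + x\<^sup>2)" using e by (simp_all add: \<delta>_def power_divide field_simps)
  have "1 - p\<^sup>2 * (sin (arcsin (y x)))\<^sup>2 = (e\<^sup>2 - x\<^sup>2) / e\<^sup>2"
    unfolding arc(2) unfolding yx using pos e(1) by (simp add: power_divide power_mult_distrib field_simps)
  also have "\<dots> = \<delta>\<^sup>2" using e(2) by (simp add: \<delta>_def power_divide)
  finally have "1 - p\<^sup>2 * (sin (arcsin (y x)))\<^sup>2 = \<delta>\<^sup>2" .
  note sub = ellF_substitution[OF p1 pos(2) arc(1) \<delta>(1) this]
  have S': "S = (\<lambda>x. ellF p (arcsin (y x)) / \<Xi>)" by (simp add: S y_def)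
  have "- 1 / (p * e ^ 3) / z / (\<Xi> * \<delta>) = \<rho> * inverse (e\<^sup>2) / C"
    unfolding sq(2) z_def \<delta>_def using pos e(1) \<rho> by (simp add: field_simps power2_eq_square power3_eq_cube)
  then show "(S has_real_derivative \<rho> * inverse (1 + x\<^sup>2) / C) (at x)"
    using sub(1) unfolding S' e(2) by simp
  show "sqrt (C / (K - 1)) * jacobi_nc p (\<Xi> * S x) = \<rho>"
    unfolding S' jacobi_nc_def sub(3) arc(3) nc z_def using pos \<rho> by simp
  show "((\<lambda>s. 1 / \<Xi> * ellE p (jacobi_am p (\<Xi> * s))) has_real_derivative inverse (1 + x\<^sup>2)) (at (S x))"
    using ellE_profile_derivative[OF p1, of \<Xi> "S x"] pos(2) \<delta>(2) unfolding S' sub(2) by simp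
qed

text \<open>With $p^2 = K$ the first integral gives $\mathrm{cn}^2 = C / (p^2 \rho^2) = 1 - 1 / (p^2 (1+x^2))$.
  The slope does not vanish, since $w < K < 1$, and it is infinite where the amplitude is zero. The sign \<open>\<sigma>\<close>
  distinguishes the two branches of the profile.\<close>

lemma profile_between_negative:
  fixes K C x \<rho> \<sigma> :: real
  assumes K: "0 < K" "K < 1" and C: "C > 0" and \<rho>: "\<rho> > 0"
    and I: "(inverse (1 + x\<^sup>2) - K) * \<rho>\<^sup>2 = - C"
    and p: "p = sqrt K" and \<Xi>: "\<Xi> = sqrt C" and \<sigma>: "\<sigma>\<^sup>2 = 1" "\<sigma> * x < 0"
    and S: "S = (\<lambda>x. ellF p (arcsin (\<sigma> / (p * sqrt (1 + x\<^sup>2)))) / \<Xi>)"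
  shows "(S has_real_derivative \<rho> * inverse (1 + x\<^sup>2) / C) (at x)"
    and "sqrt (C / K) * jacobi_nc p (\<Xi> * S x) = \<rho>"
    and "((\<lambda>s. s - 1 / \<Xi> * ellE p (jacobi_am p (\<Xi> * s))) has_real_derivative inverse (1 + x\<^sup>2)) (at (S x))"
proof -
  have pos: "p > 0" "\<Xi> > 0" using K C by (simp_all add: p \<Xi>)
  have sq: "K = p\<^sup>2" "C = \<Xi>\<^sup>2" using K C by (simp_all add: p \<Xi>)
  have p1: "p\<^sup>2 < 1" using K by (simp add: p)
  have nc: "sqrt (C / K) = \<Xi> / p"
    by (simp only: p \<Xi> real_sqrt_divide)
  define e where "e = sqrt (1 + x\<^sup>2)"
  have e: "e > 0" "e\<^sup>2 = 1 + x\<^sup>2" by (simp_all add: e_def add_pos_nonneg)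
  have key: "\<rho>\<^sup>2 * (p\<^sup>2 * e\<^sup>2 - 1) = \<Xi>\<^sup>2 * e\<^sup>2"
    using I e unfolding sq(1,2) e(2)[symmetric] by (simp add: field_simps)
  define y where "y = (\<lambda>x. \<sigma> / (p * sqrt (1 + x\<^sup>2)))"
  have yx: "y x = \<sigma> / (p * e)" by (simp add: y_def e_def)
  have y': "(y has_real_derivative - (\<sigma> * x) / (p * e ^ 3)) (at x)"
  proof -
    have "(y has_real_derivative (0 * (p * e) - \<sigma> * (p * (x / e))) / ((p * e) * (p * e))) (at x)"
      unfolding y_def e_def
      by (intro DERIV_divide DERIV_const DERIV_cmult sqrt_one_plus_square_derivative)
         (use pos e in \<open>simp add: e_def\<close>)
    moreover have "(0 * (p * e) - \<sigma> * (p * (x / e))) / ((p * e) * (p * e)) = - (\<sigma> * x) / (p * e ^ 3)"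
      using pos e(1) by (simp add: field_simps power2_eq_square power3_eq_cube)
    ultimately show ?thesis by simp
  qed
  define z where "z = \<Xi> / (p * \<rho>)"
  have z: "z > 0" using pos \<rho> by (simp add: z_def)
  have "1 - (y x)\<^sup>2 = (p\<^sup>2 * e\<^sup>2 - 1) / (p\<^sup>2 * e\<^sup>2)"
    unfolding yx using pos e(1) by (simp add: power_divide power_mult_distrib \<sigma>(1) field_simps)
  also have "\<dots> = (\<rho>\<^sup>2 * (p\<^sup>2 * e\<^sup>2 - 1)) / (\<rho>\<^sup>2 * (p\<^sup>2 * e\<^sup>2))" using \<rho> by simp
  also have "\<dots> = z\<^sup>2"
    unfolding key z_def using pos e(1) \<rho> by (simp add: power_divide power_mult_distrib mult.commute)
  finally have yz: "1 - (y x)\<^sup>2 = z\<^sup>2" .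
  note arc = arcsin_has_real_derivative[OF y' z yz]
  define \<delta> where "\<delta> = - (\<sigma> * x) / e"
  have \<delta>: "\<delta> > 0" using divide_neg_pos[OF \<sigma>(2) e(1)] by (simp add: \<delta>_def)
  have \<delta>2: "\<delta>\<^sup>2 = x\<^sup>2 / e\<^sup>2" by (simp add: \<delta>_def power_divide power_mult_distrib \<sigma>(1))
  have "1 - p\<^sup>2 * (sin (arcsin (y x)))\<^sup>2 = (e\<^sup>2 - 1) / e\<^sup>2"
    unfolding arc(2) unfolding yx using pos e(1) by (simp add: power_divide power_mult_distrib \<sigma>(1) field_simps)
  also have "\<dots> = \<delta>\<^sup>2" unfolding \<delta>2 using e(2) by simp
  finally have "1 - p\<^sup>2 * (sin (arcsin (y x)))\<^sup>2 = \<delta>\<^sup>2" .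
  note sub = ellF_substitution[OF p1 pos(2) arc(1) \<delta> this]
  have S': "S = (\<lambda>x. ellF p (arcsin (y x)) / \<Xi>)" by (simp add: S y_def)
  have "\<sigma> * x \<noteq> 0" using \<sigma>(2) by (rule less_imp_neq)
  then have "- (\<sigma> * x) / (p * e ^ 3) / z / (\<Xi> * \<delta>) = \<rho> * inverse (e\<^sup>2) / C"
    unfolding sq(2) z_def \<delta>_def using pos e(1) \<rho>
    by (simp add: field_simps power2_eq_square power3_eq_cube)
  then show "(S has_real_derivative \<rho> * inverse (1 + x\<^sup>2) / C) (at x)"
    using sub(1) unfolding S' e(2) by simp
  show "sqrt (C / K) * jacobi_nc p (\<Xi> * S x) = \<rho>"
    unfolding S' jacobi_nc_def sub(3) arc(3) nc z_def using pos \<rho> by simp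
  have "((\<lambda>s. s - 1 / \<Xi> * ellE p (jacobi_am p (\<Xi> * s))) has_real_derivative 1 - \<delta>\<^sup>2) (at (S x))"
    using DERIV_diff[OF DERIV_ident ellE_profile_derivative[OF p1, of \<Xi> "S x"]] pos(2)
    unfolding S' sub(2) by simp
  moreover have "1 - \<delta>\<^sup>2 = inverse (e\<^sup>2)"
  proof -
    have "1 - \<delta>\<^sup>2 = (e\<^sup>2 - x\<^sup>2) / e\<^sup>2" unfolding \<delta>2 using e(1) by (simp add: diff_divide_distrib)
    then show ?thesis using e(2) by (simp add: divide_inverse)
  qed
  ultimately show "((\<lambda>s. s - 1 / \<Xi> * ellE p (jacobi_am p (\<Xi> * s))) has_real_derivative inverse (1 + x\<^sup>2)) (at (S x))"
    unfolding e(2) by simp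
qed

text \<open>The first integral reads $\cosh^2(ps) = \rho^2 / p^2 = 1 + 1/x^2$; it excludes \<open>x = 0\<close>.\<close>

lemma profile_one:
  fixes C x \<rho> :: real
  assumes C: "C > 0" and \<rho>: "\<rho> > 0"
    and I: "(inverse (1 + x\<^sup>2) - 1) * \<rho>\<^sup>2 = - C" and p: "p = sqrt C"
    and S: "S = (\<lambda>x. arsinh (- 1 / x) / p)"
  shows "(S has_real_derivative \<rho> * inverse (1 + x\<^sup>2) / C) (at x)"
    and "p * cosh (p * S x) = \<rho>"
    and "((\<lambda>s. s - tanh (p * s) / p) has_real_derivative inverse (1 + x\<^sup>2)) (at (S x))"
proof -
  have pos: "p > 0" and Cp: "C = p\<^sup>2" using C by (simp_all add: p)
  have x: "x \<noteq> 0" using I C by auto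
  define X where "X = 1 + x\<^sup>2"
  have X: "X > 0" by (simp add: X_def add_pos_nonneg)
  have key: "x\<^sup>2 * \<rho>\<^sup>2 = p\<^sup>2 * X"
  proof -
    have "(1 - X) * \<rho>\<^sup>2 = - C * X" using I X unfolding X_def[symmetric] by (simp add: field_simps)
    then show ?thesis by (simp add: X_def Cp)
  qed
  have "(- 1 / x)\<^sup>2 + 1 = (\<rho> / p)\<^sup>2"
    using key x pos by (simp add: X_def power_divide field_simps)
  then have root: "sqrt ((- 1 / x)\<^sup>2 + 1) = \<rho> / p" using pos \<rho> by simp
  have "((\<lambda>x. - 1 / x) has_real_derivative 1 / x\<^sup>2) (at x)"
    using x by (auto intro!: derivative_eq_intros simp: field_simps power2_eq_square)
  from DERIV_chain2[OF arsinh_real_has_field_derivative this]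
  have "((\<lambda>x. arsinh (- 1 / x)) has_real_derivative 1 / (\<rho> / p) * (1 / x\<^sup>2)) (at x)"
    unfolding root .
  from DERIV_cdivide[OF this, of p]
  have "(S has_real_derivative 1 / (\<rho> / p) * (1 / x\<^sup>2) / p) (at x)" unfolding S .
  moreover have "1 / (\<rho> / p) * (1 / x\<^sup>2) / p = \<rho> * inverse X / C"
    unfolding Cp using key x pos \<rho> X by (simp add: field_simps power2_eq_square)
  ultimately show "(S has_real_derivative \<rho> * inverse (1 + x\<^sup>2) / C) (at x)"
    unfolding X_def by simp
  have "p * S x = arsinh (- 1 / x)" using pos by (simp add: S)
  then have ch: "cosh (p * S x) = \<rho> / p" by (simp only: cosh_arsinh_real root)
  then show "p * cosh (p * S x) = \<rho>" using pos by simp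
  have "((\<lambda>s. s - tanh (p * s) / p) has_real_derivative (tanh (p * S x))\<^sup>2) (at (S x))"
    using pos by (auto intro!: derivative_eq_intros simp: field_simps)
  moreover have "(tanh (p * S x))\<^sup>2 = inverse X"
  proof -
    have "(tanh (p * S x))\<^sup>2 = ((cosh (p * S x))\<^sup>2 - 1) / (cosh (p * S x))\<^sup>2"
      by (simp add: tanh_def power_divide sinh_square_eq)
    also have "\<dots> = (\<rho>\<^sup>2 - p\<^sup>2) / \<rho>\<^sup>2" unfolding ch using pos \<rho> by (simp add: power_divide field_simps)
    also have "\<dots> = (x\<^sup>2 * \<rho>\<^sup>2 - x\<^sup>2 * p\<^sup>2) / (x\<^sup>2 * \<rho>\<^sup>2)"
      using x \<rho> by (simp add: field_simps)
    also have "\<dots> = p\<^sup>2 * (X - x\<^sup>2) / (p\<^sup>2 * X)" unfolding key by (simp add: algebra_simps)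
    also have "X - x\<^sup>2 = 1" by (simp add: X_def)
    also have "p\<^sup>2 * 1 / (p\<^sup>2 * X) = inverse X" using pos by (simp add: field_simps)
    finally show ?thesis .
  qed
  ultimately show "((\<lambda>s. s - tanh (p * s) / p) has_real_derivative inverse (1 + x\<^sup>2)) (at (S x))"
    unfolding X_def by simp
qed

section \<open>The classification\<close>

theorem theorem6p8:
  fixes f :: "real \<times> real \<Rightarrow> real^4" and U :: "(real \<times> real) set" and K :: real
  assumes "surface_of_parabolic_rotation f U"
    and "K \<noteq> 0"
    and "\<forall>u\<in>U. gauss_curvature f u = K"
    and "\<not> tubular f U"
  shows "\<exists>b0 b1 b2 b3 r \<psi> I \<phi>.
    pseudo_orthonormal b0 b1 b2 b3 \<and> open I \<and> is_interval I \<and> (\<forall>s\<in>I. r s > 0) \<and>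
    reparametrisation \<phi> U (I \<times> UNIV) \<and>
    (\<forall>u\<in>U. f u = parabolic_param b0 b1 b2 b3 r \<psi> (\<phi> u)) \<and>
    (K < 0 \<longrightarrow>
      (\<exists>C p \<Xi>. C < 0 \<and> p = sqrt (1 / (1 - K)) \<and> \<Xi> = sqrt ((K - 1) * C) \<and>
        r = (\<lambda>s. sqrt (C / K) * jacobi_dn p (\<Xi> * s)) \<and>
        \<psi> = (\<lambda>s. K * s - K / \<Xi> * ellPi (p\<^sup>2) (\<Xi> * s) p))) \<and>
    (0 < K \<and> K < 1 \<longrightarrow>
      (\<exists>C p \<Xi>. C < 0 \<and> p = sqrt (1 - K) \<and> \<Xi> = sqrt (- C) \<and>
        r = (\<lambda>s. sqrt (C / (K - 1)) * jacobi_nc p (\<Xi> * s)) \<and>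
        \<psi> = (\<lambda>s. 1 / \<Xi> * ellE p (jacobi_am p (\<Xi> * s)))) \<or>
      (\<exists>C p \<Xi>. C > 0 \<and> p = sqrt K \<and> \<Xi> = sqrt C \<and>
        r = (\<lambda>s. sqrt (C / K) * jacobi_nc p (\<Xi> * s)) \<and>
        \<psi> = (\<lambda>s. s - 1 / \<Xi> * ellE p (jacobi_am p (\<Xi> * s))))) \<and>
    (K = 1 \<longrightarrow>
      (\<exists>p. p > 0 \<and>
        r = (\<lambda>s. p * cosh (p * s)) \<and>
        \<psi> = (\<lambda>s. s - tanh (p * s) / p))) \<and>
    (K > 1 \<longrightarrow>
      (\<exists>C p \<Xi>. C > 0 \<and> p = sqrt (1 / K) \<and> \<Xi> = sqrt (K * C) \<and>
        r = (\<lambda>s. sqrt (C / (K - 1)) * jacobi_dn p (\<Xi> * s)) \<and>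
        \<psi> = (\<lambda>s. K * s - (K - 1) / \<Xi> * ellPi (p\<^sup>2) (\<Xi> * s) p)))"
proof -
  obtain R where surf: "surface_in_hyp3 f U" and R: "parabolic_rotation_group R" "\<And>t. R t ` f ` U = f ` U"
    using assms(1) unfolding surface_of_parabolic_rotation_def by blast
  obtain b0 b1 b2 b3 where b: "pseudo_orthonormal b0 b1 b2 b3" "\<And>x. x \<in> hyp3 \<Longrightarrow> mink x b0 < 0"
    "\<And>t x. mink (R t x) b0 = mink x b0" "\<And>t x. mink (R t x) b2 = mink x b2 - t * mink x b0"
    "\<And>t x. mink (R t x) b3 = mink x b3"
    using parabolic_rotation_group_basis[OF R(1)] by metis
  interpret parabolic_surface_constant_curvature f U b0 b1 b2 b3 K
  proof
    show "mink (f u) b0 < 0" if "u \<in> U" for u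
      using surf that by (intro b(2)) (auto simp: surface_in_hyp3_def)
    show "\<exists>u'\<in>U. mink (f u') b0 = mink (f u) b0 \<and> mink (f u') b2 = mink (f u) b2 - t * mink (f u) b0 \<and>
        mink (f u') b3 = mink (f u) b3" if u: "u \<in> U" for u t
    proof -
      have "R t (f u) \<in> f ` U" using R(2)[of t] u by blast
      then obtain u' where "u' \<in> U" "f u' = R t (f u)" by auto
      then show ?thesis by (intro bexI[of _ u']) (simp_all add: b(3-5))
    qed
  qed (use surf b(1) assms(2-4) in auto)
  obtain u0 where u0: "u0 \<in> U" using neU by blast
  define C where "C = - c u0"
  have cC: "c u = - C" if "u \<in> U" for u using first_integral[OF that u0] by (simp add: C_def)
  have int: "(inverse (1 + (m u)\<^sup>2) - K) * (r u)\<^sup>2 = - C" if "u \<in> U" for u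
    using cC[OF that] by (simp add: c_def)
  have C0: "C \<noteq> 0" using first_integral_nonzero[OF u0] by (simp add: C_def)
  have w: "0 < inverse (1 + (m u0)\<^sup>2)" "inverse (1 + (m u0)\<^sup>2) \<le> 1"
    by (simp_all add: add_pos_nonneg inverse_le_1_iff)
  have C_neg: "C < 0" if "K < 0"
  proof -
    have "0 < inverse (1 + (m u0)\<^sup>2) - K" using w(1) that by linarith
    moreover have "0 < (r u0)\<^sup>2" using r_pos[OF u0] by simp
    ultimately have "0 < (inverse (1 + (m u0)\<^sup>2) - K) * (r u0)\<^sup>2" by (rule mult_pos_pos)
    then show ?thesis using int[OF u0] by simp
  qed
  have C_pos: "C > 0" if "K \<ge> 1"
  proof -
    have "(inverse (1 + (m u0)\<^sup>2) - K) * (r u0)\<^sup>2 \<le> 0"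
      using w(2) that by (intro mult_nonpos_nonneg) auto
    then show ?thesis using int[OF u0] C0 by simp
  qed
  have param: "\<exists>b0 b1 b2 b3 I \<phi>. pseudo_orthonormal b0 b1 b2 b3 \<and> open I \<and> is_interval I \<and> (\<forall>s\<in>I. R s > 0) \<and>
    reparametrisation \<phi> U (I \<times> UNIV) \<and> (\<forall>u\<in>U. f u = parabolic_param b0 b1 b2 b3 R \<Psi> (\<phi> u))"
    if "\<And>u. u \<in> U \<Longrightarrow> (S has_real_derivative r u * inverse (1 + (m u)\<^sup>2) / C) (at (m u))"
      and "\<And>u. u \<in> U \<Longrightarrow> R (S (m u)) = r u"
      and "\<And>u. u \<in> U \<Longrightarrow> (\<Psi> has_real_derivative inverse (1 + (m u)\<^sup>2)) (at (S (m u)))" for S R \<Psi>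
    by (rule parametrised_by_slope[where S = S]) (simp_all add: cC that)
  \<comment> \<open>The first integral decides the sign of \<open>C\<close> unless \<open>K\<close> lies between 0 and 1.\<close>
  consider "K < 0" | "0 < K" "K < 1" "C < 0" | "0 < K" "K < 1" "C > 0" | "K = 1" | "K > 1"
    using K C0 by linarith
  then show ?thesis
  proof cases
    case 1
    define p \<Xi> where "p = sqrt (1 / (1 - K))" and "\<Xi> = sqrt ((K - 1) * C)"
    let ?R = "\<lambda>s. sqrt (C / K) * jacobi_dn p (\<Xi> * s)"
    let ?\<Psi> = "\<lambda>s. K * s - K / \<Xi> * ellPi (p\<^sup>2) (\<Xi> * s) p"
    define S where "S = (\<lambda>x. ellF p (pi / 2 - arctan (sqrt (K / (K - 1)) * x)) / \<Xi>)"
    have prof: "(S has_real_derivative r u * inverse (1 + (m u)\<^sup>2) / C) (at (m u))" "?R (S (m u)) = r u"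
      "(?\<Psi> has_real_derivative inverse (1 + (m u)\<^sup>2)) (at (S (m u)))" if u: "u \<in> U" for u
      by (rule profile_negative[OF 1 C_neg[OF 1] r_pos[OF u] int[OF u] p_def \<Xi>_def S_def])+
    have "\<exists>C p \<Xi>. C < 0 \<and> p = sqrt (1 / (1 - K)) \<and> \<Xi> = sqrt ((K - 1) * C) \<and>
        ?R = (\<lambda>s. sqrt (C / K) * jacobi_dn p (\<Xi> * s)) \<and>
        ?\<Psi> = (\<lambda>s. K * s - K / \<Xi> * ellPi (p\<^sup>2) (\<Xi> * s) p)"
      using C_neg[OF 1] p_def \<Xi>_def by blast
    moreover obtain b0 b1 b2 b3 I \<phi> where "pseudo_orthonormal b0 b1 b2 b3" "open I" "is_interval I"
      "\<forall>s\<in>I. ?R s > 0" "reparametrisation \<phi> U (I \<times> UNIV)"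
      "\<forall>u\<in>U. f u = parabolic_param b0 b1 b2 b3 ?R ?\<Psi> (\<phi> u)"
      using param[where S = S and R = ?R and \<Psi> = ?\<Psi>, OF prof] by blast
    ultimately show ?thesis using 1
      by - (rule exI[of _ b0], rule exI[of _ b1], rule exI[of _ b2], rule exI[of _ b3], rule exI[of _ ?R],
        rule exI[of _ ?\<Psi>], rule exI[of _ I], rule exI[of _ \<phi>], simp)
  next
    case 2
    define p \<Xi> where "p = sqrt (1 - K)" and "\<Xi> = sqrt (- C)"
    let ?R = "\<lambda>s. sqrt (C / (K - 1)) * jacobi_nc p (\<Xi> * s)"
    let ?\<Psi> = "\<lambda>s. 1 / \<Xi> * ellE p (jacobi_am p (\<Xi> * s))"
    define S where "S = (\<lambda>x. ellF p (arcsin (- x / (p * sqrt (1 + x\<^sup>2)))) / \<Xi>)"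
    have prof: "(S has_real_derivative r u * inverse (1 + (m u)\<^sup>2) / C) (at (m u))" "?R (S (m u)) = r u"
      "(?\<Psi> has_real_derivative inverse (1 + (m u)\<^sup>2)) (at (S (m u)))" if u: "u \<in> U" for u
      by (rule profile_between_positive[OF 2 r_pos[OF u] int[OF u] p_def \<Xi>_def S_def])+
    have "\<exists>C p \<Xi>. C < 0 \<and> p = sqrt (1 - K) \<and> \<Xi> = sqrt (- C) \<and>
        ?R = (\<lambda>s. sqrt (C / (K - 1)) * jacobi_nc p (\<Xi> * s)) \<and>
        ?\<Psi> = (\<lambda>s. 1 / \<Xi> * ellE p (jacobi_am p (\<Xi> * s)))"
      using 2(3) p_def \<Xi>_def by blast
    moreover obtain b0 b1 b2 b3 I \<phi> where "pseudo_orthonormal b0 b1 b2 b3" "open I" "is_interval I"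
      "\<forall>s\<in>I. ?R s > 0" "reparametrisation \<phi> U (I \<times> UNIV)"
      "\<forall>u\<in>U. f u = parabolic_param b0 b1 b2 b3 ?R ?\<Psi> (\<phi> u)"
      using param[where S = S and R = ?R and \<Psi> = ?\<Psi>, OF prof] by blast
    ultimately show ?thesis using 2
      by - (rule exI[of _ b0], rule exI[of _ b1], rule exI[of _ b2], rule exI[of _ b3], rule exI[of _ ?R],
        rule exI[of _ ?\<Psi>], rule exI[of _ I], rule exI[of _ \<phi>], simp)
  next
    case 3
    have m0: "m u \<noteq> 0" if u: "u \<in> U" for u
    proof
      assume "m u = 0"
      then have "(1 - K) * (r u)\<^sup>2 = - C" using int[OF u] by simp
      moreover have "(1 - K) * (r u)\<^sup>2 \<ge> 0" using 3 by simp
      ultimately show False using 3 by simp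
    qed
    \<comment> \<open>By connectedness, the surface lies over a single branch of the profile.\<close>
    define \<sigma> where "\<sigma> = - sgn (m u0)"
    have \<sigma>: "\<sigma>\<^sup>2 = 1" using m0[OF u0] by (simp add: \<sigma>_def sgn_if)
    have \<sigma>m: "\<sigma> * m u < 0" if u: "u \<in> U" for u
      using connected_nonzero_same_sign[OF connU smooth_on_continuous[OF smooth_m] m0 u0 u]
      by (auto simp: \<sigma>_def sgn_if zero_less_mult_iff)
    define p \<Xi> where "p = sqrt K" and "\<Xi> = sqrt C"
    let ?R = "\<lambda>s. sqrt (C / K) * jacobi_nc p (\<Xi> * s)"
    let ?\<Psi> = "\<lambda>s. s - 1 / \<Xi> * ellE p (jacobi_am p (\<Xi> * s))"
    define S where "S = (\<lambda>x. ellF p (arcsin (\<sigma> / (p * sqrt (1 + x\<^sup>2)))) / \<Xi>)"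
    have prof: "(S has_real_derivative r u * inverse (1 + (m u)\<^sup>2) / C) (at (m u))" "?R (S (m u)) = r u"
      "(?\<Psi> has_real_derivative inverse (1 + (m u)\<^sup>2)) (at (S (m u)))" if u: "u \<in> U" for u
      by (rule profile_between_negative[OF 3 r_pos[OF u] int[OF u] p_def \<Xi>_def \<sigma> \<sigma>m[OF u] S_def])+
    have "\<exists>C p \<Xi>. C > 0 \<and> p = sqrt K \<and> \<Xi> = sqrt C \<and>
        ?R = (\<lambda>s. sqrt (C / K) * jacobi_nc p (\<Xi> * s)) \<and>
        ?\<Psi> = (\<lambda>s. s - 1 / \<Xi> * ellE p (jacobi_am p (\<Xi> * s)))"
      using 3(3) p_def \<Xi>_def by blast
    moreover obtain b0 b1 b2 b3 I \<phi> where "pseudo_orthonormal b0 b1 b2 b3" "open I" "is_interval I"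
      "\<forall>s\<in>I. ?R s > 0" "reparametrisation \<phi> U (I \<times> UNIV)"
      "\<forall>u\<in>U. f u = parabolic_param b0 b1 b2 b3 ?R ?\<Psi> (\<phi> u)"
      using param[where S = S and R = ?R and \<Psi> = ?\<Psi>, OF prof] by blast
    ultimately show ?thesis using 3
      by - (rule exI[of _ b0], rule exI[of _ b1], rule exI[of _ b2], rule exI[of _ b3], rule exI[of _ ?R],
        rule exI[of _ ?\<Psi>], rule exI[of _ I], rule exI[of _ \<phi>], simp)
  next
    case 4
    then have C: "C > 0" using C_pos by simp
    define p where "p = sqrt C"
    let ?R = "\<lambda>s. p * cosh (p * s)"
    let ?\<Psi> = "\<lambda>s. s - tanh (p * s) / p"
    define S where "S = (\<lambda>x. arsinh (- 1 / x) / p)"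
    have prof: "(S has_real_derivative r u * inverse (1 + (m u)\<^sup>2) / C) (at (m u))" "?R (S (m u)) = r u"
      "(?\<Psi> has_real_derivative inverse (1 + (m u)\<^sup>2)) (at (S (m u)))" if u: "u \<in> U" for u
      by (rule profile_one[OF C r_pos[OF u] int[OF u, unfolded 4] p_def S_def])+
    have "\<exists>p. p > 0 \<and> ?R = (\<lambda>s. p * cosh (p * s)) \<and> ?\<Psi> = (\<lambda>s. s - tanh (p * s) / p)"
      using C by (intro exI[of _ p]) (simp add: p_def)
    moreover obtain b0 b1 b2 b3 I \<phi> where "pseudo_orthonormal b0 b1 b2 b3" "open I" "is_interval I"
      "\<forall>s\<in>I. ?R s > 0" "reparametrisation \<phi> U (I \<times> UNIV)"
      "\<forall>u\<in>U. f u = parabolic_param b0 b1 b2 b3 ?R ?\<Psi> (\<phi> u)"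
      using param[where S = S and R = ?R and \<Psi> = ?\<Psi>, OF prof] by blast
    ultimately show ?thesis using 4
      by - (rule exI[of _ b0], rule exI[of _ b1], rule exI[of _ b2], rule exI[of _ b3], rule exI[of _ ?R],
        rule exI[of _ ?\<Psi>], rule exI[of _ I], rule exI[of _ \<phi>], simp)
  next
    case 5
    then have C: "C > 0" using C_pos by simp
    define p \<Xi> where "p = sqrt (1 / K)" and "\<Xi> = sqrt (K * C)"
    let ?R = "\<lambda>s. sqrt (C / (K - 1)) * jacobi_dn p (\<Xi> * s)"
    let ?\<Psi> = "\<lambda>s. K * s - (K - 1) / \<Xi> * ellPi (p\<^sup>2) (\<Xi> * s) p"
    define S where "S = (\<lambda>x. ellF p (arctan (sqrt (K / (K - 1)) * x)) / \<Xi>)"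
    have prof: "(S has_real_derivative r u * inverse (1 + (m u)\<^sup>2) / C) (at (m u))" "?R (S (m u)) = r u"
      "(?\<Psi> has_real_derivative inverse (1 + (m u)\<^sup>2)) (at (S (m u)))" if u: "u \<in> U" for u
      by (rule profile_gt_1[OF 5 C r_pos[OF u] int[OF u] p_def \<Xi>_def S_def])+
    have "\<exists>C p \<Xi>. C > 0 \<and> p = sqrt (1 / K) \<and> \<Xi> = sqrt (K * C) \<and>
        ?R = (\<lambda>s. sqrt (C / (K - 1)) * jacobi_dn p (\<Xi> * s)) \<and>
        ?\<Psi> = (\<lambda>s. K * s - (K - 1) / \<Xi> * ellPi (p\<^sup>2) (\<Xi> * s) p)"
      using C p_def \<Xi>_def by blast
    moreover obtain b0 b1 b2 b3 I \<phi> where "pseudo_orthonormal b0 b1 b2 b3" "open I" "is_interval I"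
      "\<forall>s\<in>I. ?R s > 0" "reparametrisation \<phi> U (I \<times> UNIV)"
      "\<forall>u\<in>U. f u = parabolic_param b0 b1 b2 b3 ?R ?\<Psi> (\<phi> u)"
      using param[where S = S and R = ?R and \<Psi> = ?\<Psi>, OF prof] by blast
    ultimately show ?thesis using 5
      by - (rule exI[of _ b0], rule exI[of _ b1], rule exI[of _ b2], rule exI[of _ b3], rule exI[of _ ?R],
        rule exI[of _ ?\<Psi>], rule exI[of _ I], rule exI[of _ \<phi>], simp)
  qed
qed

end
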